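(* Let $F$ be a field, let $r\geq 1$ be an integer and let $\varphi=(\varphi_1,\ldots,\varphi_r)$ be a system of $r$ quadratic forms defined on a finite-dimensional $F$-vector space $V$ with $\dim_F V\geq \frac{r(r+1)}{2}+1$. Then there exists a generalized $2$-extension $F'/F$ with $[F':F]\leq 2^r$ such that $\varphi_{F'}$ is isotropic.
   Context: A system of $r$ quadratic forms on a finite-dimensional $F$-vector space $V$ is an $r$-tuple $\varphi=(\varphi_1,\ldots,\varphi_r)$ of quadratic forms $\varphi_i:V\to F$. It is called isotropic if there exists a nonzero vector $v\in V$ with $\varphi_i(v)=0$ for all $1\leq i\leq r$, and anisotropic otherwise. For a field extension $K/F$, $\varphi_K$ denotes the system of quadratic forms over $K$ on the $K$-vector space $K\otimes_F V$ obtained from $\varphi$ by scalar extension. A finite field extension $K/F$ is called a generalized $2$-extension if there exist $m\in\mathbb{N}$ (with $m=0$ allowed) and intermediate fields $F=K_0\subseteq K_1\subseteq\cdots\subseteq K_m=K$ such that $K_i/K_{i-1}$ is a quadratic field extension (i.e. a field extension of degree $2$, separable or not) for $1\leq i\leq m$. *)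

theory Defs
  imports
    "HOL-Algebra.Algebra"
    "Jordan_Normal_Form.Missing_VectorSpace"
begin

section \<open>Quadratic forms and systems of quadratic forms\<close>

definition bilinear_form ::
    "('a, 'm) ring_scheme \<Rightarrow> ('a, 'v, 'p) module_scheme \<Rightarrow> ('v \<Rightarrow> 'v \<Rightarrow> 'a) \<Rightarrow> bool"
  where "bilinear_form K V b \<longleftrightarrow>
    (\<forall>u \<in> carrier V. \<forall>v \<in> carrier V. b u v \<in> carrier K) \<and>
    (\<forall>u \<in> carrier V. \<forall>v \<in> carrier V. \<forall>w \<in> carrier V.
        b (u \<oplus>\<^bsub>V\<^esub> v) w = b u w \<oplus>\<^bsub>K\<^esub> b v w \<and>
        b w (u \<oplus>\<^bsub>V\<^esub> v) = b w u \<oplus>\<^bsub>K\<^esub> b w v) \<and>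
    (\<forall>a \<in> carrier K. \<forall>u \<in> carrier V. \<forall>v \<in> carrier V.
        b (a \<odot>\<^bsub>V\<^esub> u) v = a \<otimes>\<^bsub>K\<^esub> b u v \<and>
        b u (a \<odot>\<^bsub>V\<^esub> v) = a \<otimes>\<^bsub>K\<^esub> b u v)"

definition polar_form ::
    "('a, 'm) ring_scheme \<Rightarrow> ('a, 'v, 'p) module_scheme \<Rightarrow> ('v \<Rightarrow> 'a) \<Rightarrow> 'v \<Rightarrow> 'v \<Rightarrow> 'a"
  where "polar_form K V q u v = q (u \<oplus>\<^bsub>V\<^esub> v) \<ominus>\<^bsub>K\<^esub> q u \<ominus>\<^bsub>K\<^esub> q v"

text \<open>This definition is characteristic free: in characteristic 2 a quadratic form is not
  determined by its polar form.\<close>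

definition quadratic_form ::
    "('a, 'm) ring_scheme \<Rightarrow> ('a, 'v, 'p) module_scheme \<Rightarrow> ('v \<Rightarrow> 'a) \<Rightarrow> bool"
  where "quadratic_form K V q \<longleftrightarrow>
    q \<in> carrier V \<rightarrow> carrier K \<and>
    (\<forall>a \<in> carrier K. \<forall>v \<in> carrier V. q (a \<odot>\<^bsub>V\<^esub> v) = (a \<otimes>\<^bsub>K\<^esub> a) \<otimes>\<^bsub>K\<^esub> q v) \<and>
    bilinear_form K V (polar_form K V q)"

text \<open>A system of \<open>r\<close> quadratic forms, i.e. an \<open>r\<close>-tuple, is a list of length \<open>r\<close>.\<close>

definition quadratic_system ::
    "('a, 'm) ring_scheme \<Rightarrow> ('a, 'v, 'p) module_scheme \<Rightarrow> ('v \<Rightarrow> 'a) list \<Rightarrow> bool"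
  where "quadratic_system K V \<phi> \<longleftrightarrow> (\<forall>q \<in> set \<phi>. quadratic_form K V q)"

definition isotropic ::
    "('a, 'm) ring_scheme \<Rightarrow> ('a, 'v, 'p) module_scheme \<Rightarrow> ('v \<Rightarrow> 'a) list \<Rightarrow> bool"
  where "isotropic K V \<phi> \<longleftrightarrow>
    (\<exists>v \<in> carrier V. v \<noteq> \<zero>\<^bsub>V\<^esub> \<and> (\<forall>q \<in> set \<phi>. q v = \<zero>\<^bsub>K\<^esub>))"


section \<open>Field extensions\<close>

text \<open>An extension \<open>K/F\<close> is given by fields \<open>F\<close>, \<open>K\<close> and an embedding \<open>j\<close> of \<open>F\<close> into \<open>K\<close>;
  \<open>F\<close> is identified with the subfield \<open>j ` carrier F\<close> of \<open>K\<close>.\<close>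

definition field_extension ::
    "('a, 'm) ring_scheme \<Rightarrow> ('k, 'n) ring_scheme \<Rightarrow> ('a \<Rightarrow> 'k) \<Rightarrow> bool"
  where "field_extension F K j \<longleftrightarrow> field F \<and> field K \<and> j \<in> ring_hom F K"

definition finite_field_extension ::
    "('a, 'm) ring_scheme \<Rightarrow> ('k, 'n) ring_scheme \<Rightarrow> ('a \<Rightarrow> 'k) \<Rightarrow> bool"
  where "finite_field_extension F K j \<longleftrightarrow>
    field_extension F K j \<and> ring.finite_dimension K (j ` carrier F) (carrier K)"

definition extension_degree ::
    "('a, 'm) ring_scheme \<Rightarrow> ('k, 'n) ring_scheme \<Rightarrow> ('a \<Rightarrow> 'k) \<Rightarrow> nat"
  where "extension_degree F K j = ring.dim K (j ` carrier F) (carrier K)"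

text \<open>The intermediate fields form a tower \<open>T 0, \<dots>, T m\<close> of subfields of \<open>K\<close>;
  \<open>ring.dimension K n A B\<close> says that \<open>B\<close> has dimension \<open>n\<close> over the subfield \<open>A\<close> of \<open>K\<close>.\<close>

definition generalized_2_extension ::
    "('a, 'm) ring_scheme \<Rightarrow> ('k, 'n) ring_scheme \<Rightarrow> ('a \<Rightarrow> 'k) \<Rightarrow> bool"
  where "generalized_2_extension F K j \<longleftrightarrow>
    finite_field_extension F K j \<and>
    (\<exists>(m::nat) T. T 0 = j ` carrier F \<and> T m = carrier K \<and>
      (\<forall>i \<le> m. subfield (T i) K) \<and>
      (\<forall>i \<in> {1..m}. T (i - 1) \<subseteq> T i \<and> ring.dimension K 2 (T (i - 1)) (T i)))"


section \<open>Scalar extension\<close>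

text \<open>Finitely supported functions from \<open>S\<close> to \<open>K\<close>, extended by zero outside \<open>S\<close>. Here and
  below, the ring multiplication and unit of a module record carry no meaning.\<close>

definition free_module :: "('k, 'n) ring_scheme \<Rightarrow> 's set \<Rightarrow> ('k, 's \<Rightarrow> 'k) module"
  where "free_module K S =
    \<lparr> carrier = {x. (\<forall>s. x s \<in> carrier K) \<and> (\<forall>s. s \<notin> S \<longrightarrow> x s = \<zero>\<^bsub>K\<^esub>) \<and>
                  finite {s. x s \<noteq> \<zero>\<^bsub>K\<^esub>}},
      monoid.mult = undefined, monoid.one = undefined,
      ring.zero = (\<lambda>s. \<zero>\<^bsub>K\<^esub>),
      ring.add = (\<lambda>x y s. x s \<oplus>\<^bsub>K\<^esub> y s),
      smult = (\<lambda>a x s. a \<otimes>\<^bsub>K\<^esub> x s) \<rparr>"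

definition free_gen :: "('k, 'n) ring_scheme \<Rightarrow> 's \<Rightarrow> 's \<Rightarrow> 'k"
  where "free_gen K s = (\<lambda>t. if t = s then \<one>\<^bsub>K\<^esub> else \<zero>\<^bsub>K\<^esub>)"

text \<open>For a submodule \<open>N\<close> and a coset \<open>C\<close> of \<open>N\<close>, the union defining \<open>a \<odot> C\<close> is over one and
  the same coset, as \<open>a \<odot> x\<close> and \<open>a \<odot> y\<close> are congruent modulo \<open>N\<close> for all \<open>x, y \<in> C\<close>.\<close>

definition quotient_module :: "('k, 'w, 'p) module_scheme \<Rightarrow> 'w set \<Rightarrow> ('k, 'w set) module"
  where "quotient_module M N =
    \<lparr> carrier = a_rcosets\<^bsub>M\<^esub> N,
      monoid.mult = undefined, monoid.one = undefined,
      ring.zero = N,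
      ring.add = (\<lambda>C D. C <+>\<^bsub>M\<^esub> D),
      smult = (\<lambda>a C. \<Union>x \<in> C. N +>\<^bsub>M\<^esub> (a \<odot>\<^bsub>M\<^esub> x)) \<rparr>"

text \<open>The \<open>K\<close>-vector space \<open>K \<otimes>\<^sub>F V\<close>, presented by generators \<open>1 \<otimes> v\<close> for \<open>v \<in> V\<close> subject
  to the relations \<open>1 \<otimes> (u + v) = 1 \<otimes> u + 1 \<otimes> v\<close> and \<open>1 \<otimes> (a v) = j(a) (1 \<otimes> v)\<close>
  for \<open>a \<in> F\<close>.\<close>

definition scalar_ext_relations ::
    "('a, 'm) ring_scheme \<Rightarrow> ('k, 'n) ring_scheme \<Rightarrow> ('a \<Rightarrow> 'k) \<Rightarrow> ('a, 'v, 'p) module_scheme \<Rightarrow>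
     ('v \<Rightarrow> 'k) set"
  where "scalar_ext_relations F K j V =
    (let M = free_module K (carrier V); g = free_gen K in
      {g (u \<oplus>\<^bsub>V\<^esub> v) \<ominus>\<^bsub>M\<^esub> (g u \<oplus>\<^bsub>M\<^esub> g v) | u v. u \<in> carrier V \<and> v \<in> carrier V} \<union>
      {g (a \<odot>\<^bsub>V\<^esub> v) \<ominus>\<^bsub>M\<^esub> (j a \<odot>\<^bsub>M\<^esub> g v) | a v. a \<in> carrier F \<and> v \<in> carrier V})"

definition scalar_ext_kernel ::
    "('a, 'm) ring_scheme \<Rightarrow> ('k, 'n) ring_scheme \<Rightarrow> ('a \<Rightarrow> 'k) \<Rightarrow> ('a, 'v, 'p) module_scheme \<Rightarrow>
     ('v \<Rightarrow> 'k) set"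
  where "scalar_ext_kernel F K j V =
    module.span K (free_module K (carrier V)) (scalar_ext_relations F K j V)"

definition scalar_ext ::
    "('a, 'm) ring_scheme \<Rightarrow> ('k, 'n) ring_scheme \<Rightarrow> ('a \<Rightarrow> 'k) \<Rightarrow> ('a, 'v, 'p) module_scheme \<Rightarrow>
     ('k, ('v \<Rightarrow> 'k) set) module"
  where "scalar_ext F K j V =
    quotient_module (free_module K (carrier V)) (scalar_ext_kernel F K j V)"

text \<open>The vector \<open>1 \<otimes> v\<close> of \<open>K \<otimes>\<^sub>F V\<close>.\<close>

definition scalar_ext_vec ::
    "('a, 'm) ring_scheme \<Rightarrow> ('k, 'n) ring_scheme \<Rightarrow> ('a \<Rightarrow> 'k) \<Rightarrow> ('a, 'v, 'p) module_scheme \<Rightarrow>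
     'v \<Rightarrow> ('v \<Rightarrow> 'k) set"
  where "scalar_ext_vec F K j V v =
    scalar_ext_kernel F K j V +>\<^bsub>free_module K (carrier V)\<^esub> free_gen K v"

text \<open>\<open>q\<^sub>K\<close> is the unique quadratic form on \<open>K \<otimes>\<^sub>F V\<close> with \<open>q\<^sub>K (1 \<otimes> v) = q v\<close>. Uniqueness:
  these values determine the polar form on the vectors \<open>1 \<otimes> v\<close>, which span \<open>K \<otimes>\<^sub>F V\<close>.
  As a HOL function, \<open>q\<^sub>K\<close> is only unique once its values off the carrier are fixed, hence
  \<open>extensional\<close>.\<close>

definition scalar_ext_form ::
    "('a, 'm) ring_scheme \<Rightarrow> ('k, 'n) ring_scheme \<Rightarrow> ('a \<Rightarrow> 'k) \<Rightarrow> ('a, 'v, 'p) module_scheme \<Rightarrow>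
     ('v \<Rightarrow> 'a) \<Rightarrow> ('v \<Rightarrow> 'k) set \<Rightarrow> 'k"
  where "scalar_ext_form F K j V q =
    (THE Q. Q \<in> extensional (carrier (scalar_ext F K j V)) \<and>
            quadratic_form K (scalar_ext F K j V) Q \<and>
            (\<forall>v \<in> carrier V. Q (scalar_ext_vec F K j V v) = j (q v)))"

definition scalar_ext_system ::
    "('a, 'm) ring_scheme \<Rightarrow> ('k, 'n) ring_scheme \<Rightarrow> ('a \<Rightarrow> 'k) \<Rightarrow> ('a, 'v, 'p) module_scheme \<Rightarrow>
     ('v \<Rightarrow> 'a) list \<Rightarrow> (('v \<Rightarrow> 'k) set \<Rightarrow> 'k) list"
  where "scalar_ext_system F K j V \<phi> = map (scalar_ext_form F K j V) \<phi>"


text \<open>HOL cannot quantify existentially over types, so the field \<open>F'\<close> asserted to exist must live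
  in some fixed type. This is the type of \<open>field.alg_closure\<close>, in which every field with elements
  in \<open>'a\<close> has an algebraic closure; up to isomorphism over \<open>F\<close>, the type thus contains every
  algebraic, in particular every finite, extension of \<open>F\<close>.\<close>

type_synonym 'a extension_field = "(('a list \<times> nat) multiset \<Rightarrow> 'a) ring"

end

theory Submission
  imports Defs
begin

text \<open>
  Induction on the number of forms. Pick a basis vector \<open>e\<close>. Unless all forms vanish at \<open>e\<close>, some form
  \<open>p\<close> does not, and subtracting multiples of \<open>p\<close> from the other forms makes those vanish at
  \<open>e\<close>. The vectors in the span of the remaining basis vectors that are orthogonal to \<open>e\<close> with
  respect to these \<open>r - 1\<close> forms make up a subspace of dimension at least \<open>r (r - 1) / 2 + 1\<close>, so by
  induction these forms have a common zero \<open>w\<close> in it over a tower of at most \<open>r - 1\<close> quadratic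
  extensions. They then vanish on the whole plane spanned by \<open>e\<close> and \<open>w\<close>, and one more quadratic
  extension makes \<open>p\<close> isotropic on this plane.

  All fields occurring in the towers are subfields of an algebraic closure \<open>L\<close> of \<open>F\<close>.
\<close>

section \<open>Quadratic forms on modules\<close>

text \<open>The bound r (r + 1) / 2 + 1 counts dimensions spent: the step from r - 1 to r forms
  gives up the coordinate of \<open>e\<close> and imposes r - 1 linear conditions, so it costs r;
  one more dimension provides the nonzero vector once no form is left. For \<open>p\<close> itself
  no orthogonality to \<open>e\<close> is imposed: its cross term becomes the linear coefficient of
  p(e) X^2 + b_p(e, w) X + p(w), a polynomial of degree exactly 2 in every characteristic, and a
  root a gives the zero a e + w of \<open>p\<close>. This vector is nonzero because \<open>w\<close>
  has no coordinate at \<open>e\<close>.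

  All linear algebra is done over the base field: \<open>e\<close>, the modified forms and the
  subspace are defined over it, and fields grow only after the recursive call has returned. So each
  form costs at most one quadratic step.

  The other obstacle is the scalar extension, a quotient of the free module on all vectors of V with
  its forms singled out by uniqueness. A basis of V moves everything to functions on a finite set,
  and the extended form is recognised by its values at generators and at sums of two
  generators.\<close>

text \<open>Naming a bilinear \<open>b\<close> in advance replaces the subtraction in the polar form
  by an additive identity; on the carrier the polar form is then forced to be
  \<open>b\<close>.\<close>

lemma quadratic_formI:
  assumes "cring R" and "q \<in> carrier M \<rightarrow> carrier R"
    and "\<And>a v. a \<in> carrier R \<Longrightarrow> v \<in> carrier M \<Longrightarrow> q (a \<odot>\<^bsub>M\<^esub> v) = (a \<otimes>\<^bsub>R\<^esub> a) \<otimes>\<^bsub>R\<^esub> q v"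
    and b: "bilinear_form R M b"
    and q: "\<And>u v. u \<in> carrier M \<Longrightarrow> v \<in> carrier M \<Longrightarrow> q (u \<oplus>\<^bsub>M\<^esub> v) = (q u \<oplus>\<^bsub>R\<^esub> q v) \<oplus>\<^bsub>R\<^esub> b u v"
    and M: "module R M"
  shows "quadratic_form R M q"
proof -
  interpret cring R by fact
  interpret M: module R M by fact
  have p: "polar_form R M q u v = b u v" if "u \<in> carrier M" "v \<in> carrier M" for u v
  proof -
    have "q u \<in> carrier R" "q v \<in> carrier R" "b u v \<in> carrier R"
      using assms(2) b that unfolding bilinear_form_def by auto
    then show ?thesis unfolding polar_form_def q[OF that] by algebra
  qed
  show ?thesis using assms(2,3) b unfolding quadratic_form_def bilinear_form_def
    by (auto simp: p)
qed

lemma quadratic_form_polar: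
  assumes "cring R" "quadratic_form R M q" "u \<in> carrier M" "v \<in> carrier M" "u \<oplus>\<^bsub>M\<^esub> v \<in> carrier M"
  shows "q (u \<oplus>\<^bsub>M\<^esub> v) = (q u \<oplus>\<^bsub>R\<^esub> q v) \<oplus>\<^bsub>R\<^esub> polar_form R M q u v"
proof -
  interpret cring R by fact
  have "q u \<in> carrier R" "q v \<in> carrier R" "q (u \<oplus>\<^bsub>M\<^esub> v) \<in> carrier R"
    using assms(2-) unfolding quadratic_form_def by auto
  then show ?thesis unfolding polar_form_def by algebra
qed

text \<open>Sums in \<open>N\<close> are taken only of images under \<open>f\<close>, hence are
  images of sums in \<open>M\<close>. So \<open>N\<close> may be the quotient presenting the scalar
  extension, where only the projection is under control.\<close>

lemma quadratic_form_comp: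
  assumes R: "cring R" and M: "module R M"
    and q: "quadratic_form R N q" and f: "f \<in> module_hom R M N"
  shows "quadratic_form R M (\<lambda>x. q (f x))"
proof (rule quadratic_formI[where b="\<lambda>u v. polar_form R N q (f u) (f v)", OF R _ _ _ _ M])
  interpret M: module R M by fact
  have fc: "f u \<in> carrier N" if "u \<in> carrier M" for u
    using f that by (auto simp: module_hom_def)
  note fa = module_hom_add[OF f] module_hom_smult[OF f]
  have fac: "f u \<oplus>\<^bsub>N\<^esub> f v \<in> carrier N" if "u \<in> carrier M" "v \<in> carrier M" for u v
    using fc[of "u \<oplus>\<^bsub>M\<^esub> v"] that by (simp add: fa)
  show "(\<lambda>x. q (f x)) \<in> carrier M \<rightarrow> carrier R"
    using fc q by (auto simp: quadratic_form_def)
  show "q (f (a \<odot>\<^bsub>M\<^esub> v)) = (a \<otimes>\<^bsub>R\<^esub> a) \<otimes>\<^bsub>R\<^esub> q (f v)" if "a \<in> carrier R" "v \<in> carrier M" for a v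
    using q that by (auto simp: quadratic_form_def fa fc)
  show "bilinear_form R M (\<lambda>u v. polar_form R N q (f u) (f v))"
    using q by (simp add: quadratic_form_def bilinear_form_def fa fc)
  show "q (f (u \<oplus>\<^bsub>M\<^esub> v)) = (q (f u) \<oplus>\<^bsub>R\<^esub> q (f v)) \<oplus>\<^bsub>R\<^esub> polar_form R N q (f u) (f v)"
    if "u \<in> carrier M" "v \<in> carrier M" for u v
    using that by (simp add: fa fc fac quadratic_form_polar[OF R q])
qed

lemma quadratic_form_add:
  assumes R: "cring R" and M: "module R M"
    and p: "quadratic_form R M p" and q: "quadratic_form R M q"
  shows "quadratic_form R M (\<lambda>x. p x \<oplus>\<^bsub>R\<^esub> q x)"
proof (rule quadratic_formI[where b="\<lambda>u v. polar_form R M p u v \<oplus>\<^bsub>R\<^esub> polar_form R M q u v", OF R _ _ _ _ M])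
  interpret cring R by fact
  interpret M: module R M by fact
  have c: "p v \<in> carrier R" "q v \<in> carrier R" if "v \<in> carrier M" for v
    using p q that by (auto simp: quadratic_form_def)
  have b: "polar_form R M p u v \<in> carrier R" "polar_form R M q u v \<in> carrier R"
    if "u \<in> carrier M" "v \<in> carrier M" for u v
    using p q that by (auto simp: quadratic_form_def bilinear_form_def)
  show "(\<lambda>x. p x \<oplus>\<^bsub>R\<^esub> q x) \<in> carrier M \<rightarrow> carrier R"
    using c by auto
  show "p (a \<odot>\<^bsub>M\<^esub> v) \<oplus>\<^bsub>R\<^esub> q (a \<odot>\<^bsub>M\<^esub> v) = (a \<otimes>\<^bsub>R\<^esub> a) \<otimes>\<^bsub>R\<^esub> (p v \<oplus>\<^bsub>R\<^esub> q v)"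
    if "a \<in> carrier R" "v \<in> carrier M" for a v
    using p q that by (simp add: quadratic_form_def r_distr c)
  show "bilinear_form R M (\<lambda>u v. polar_form R M p u v \<oplus>\<^bsub>R\<^esub> polar_form R M q u v)"
    using p q unfolding quadratic_form_def bilinear_form_def
    by (simp add: r_distr b a_ac)
  show "p (u \<oplus>\<^bsub>M\<^esub> v) \<oplus>\<^bsub>R\<^esub> q (u \<oplus>\<^bsub>M\<^esub> v) = ((p u \<oplus>\<^bsub>R\<^esub> q u) \<oplus>\<^bsub>R\<^esub> (p v \<oplus>\<^bsub>R\<^esub> q v)) \<oplus>\<^bsub>R\<^esub>
      (polar_form R M p u v \<oplus>\<^bsub>R\<^esub> polar_form R M q u v)"
    if "u \<in> carrier M" "v \<in> carrier M" for u v
    using that by (simp add: quadratic_form_polar[OF R] p q c b a_ac)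
qed

text \<open>A predicate on functions, which avoids viewing \<open>R\<close> as a module over
  itself.\<close>

definition linear_functional ::
    "('a, 'm) ring_scheme \<Rightarrow> ('a, 'v, 'p) module_scheme \<Rightarrow> ('v \<Rightarrow> 'a) \<Rightarrow> bool"
  where "linear_functional R M l \<longleftrightarrow> l \<in> carrier M \<rightarrow> carrier R \<and>
    (\<forall>u \<in> carrier M. \<forall>v \<in> carrier M. l (u \<oplus>\<^bsub>M\<^esub> v) = l u \<oplus>\<^bsub>R\<^esub> l v) \<and>
    (\<forall>a \<in> carrier R. \<forall>v \<in> carrier M. l (a \<odot>\<^bsub>M\<^esub> v) = a \<otimes>\<^bsub>R\<^esub> l v)"

lemma linear_functionalD:
  assumes "linear_functional R M l"
  shows "v \<in> carrier M \<Longrightarrow> l v \<in> carrier R"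
    and "u \<in> carrier M \<Longrightarrow> v \<in> carrier M \<Longrightarrow> l (u \<oplus>\<^bsub>M\<^esub> v) = l u \<oplus>\<^bsub>R\<^esub> l v"
    and "a \<in> carrier R \<Longrightarrow> v \<in> carrier M \<Longrightarrow> l (a \<odot>\<^bsub>M\<^esub> v) = a \<otimes>\<^bsub>R\<^esub> l v"
  using assms by (auto simp: linear_functional_def)

lemma linear_functional_comp:
  assumes "linear_functional R N l" "f \<in> module_hom R M N"
  shows "linear_functional R M (\<lambda>x. l (f x))"
proof -
  have fc: "f u \<in> carrier N" if "u \<in> carrier M" for u
    using assms(2) that by (auto simp: module_hom_def)
  show ?thesis
    using fc module_hom_add[OF assms(2)] module_hom_smult[OF assms(2)] linear_functionalD[OF assms(1)]
    by (simp add: linear_functional_def)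
qed

lemma linear_functional_polar:
  assumes "quadratic_form R M q" "u \<in> carrier M"
  shows "linear_functional R M (polar_form R M q u)"
  using assms by (auto simp: linear_functional_def quadratic_form_def bilinear_form_def)

text \<open>The monomials of a form written in coordinates are of this kind; the polar form is the
  symmetrised product, without any division by 2.\<close>

lemma quadratic_form_mult:
  assumes R: "cring R" and M: "module R M"
    and k: "linear_functional R M k" and l: "linear_functional R M l"
  shows "quadratic_form R M (\<lambda>x. k x \<otimes>\<^bsub>R\<^esub> l x)"
proof (rule quadratic_formI[where b="\<lambda>u v. k u \<otimes>\<^bsub>R\<^esub> l v \<oplus>\<^bsub>R\<^esub> k v \<otimes>\<^bsub>R\<^esub> l u", OF R _ _ _ _ M])
  interpret cring R by fact
  interpret M: module R M by fact
  note kl = linear_functionalD[OF k] linear_functionalD[OF l]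
  show "(\<lambda>x. k x \<otimes>\<^bsub>R\<^esub> l x) \<in> carrier M \<rightarrow> carrier R"
    using kl by auto
  show "k (a \<odot>\<^bsub>M\<^esub> v) \<otimes>\<^bsub>R\<^esub> l (a \<odot>\<^bsub>M\<^esub> v) = (a \<otimes>\<^bsub>R\<^esub> a) \<otimes>\<^bsub>R\<^esub> (k v \<otimes>\<^bsub>R\<^esub> l v)"
    if "a \<in> carrier R" "v \<in> carrier M" for a v
    using that by (simp add: kl m_ac)
  show "bilinear_form R M (\<lambda>u v. k u \<otimes>\<^bsub>R\<^esub> l v \<oplus>\<^bsub>R\<^esub> k v \<otimes>\<^bsub>R\<^esub> l u)"
    unfolding bilinear_form_def by (auto simp: kl l_distr r_distr a_ac m_ac)
  show "k (u \<oplus>\<^bsub>M\<^esub> v) \<otimes>\<^bsub>R\<^esub> l (u \<oplus>\<^bsub>M\<^esub> v) = (k u \<otimes>\<^bsub>R\<^esub> l u \<oplus>\<^bsub>R\<^esub> k v \<otimes>\<^bsub>R\<^esub> l v) \<oplus>\<^bsub>R\<^esub>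
      (k u \<otimes>\<^bsub>R\<^esub> l v \<oplus>\<^bsub>R\<^esub> k v \<otimes>\<^bsub>R\<^esub> l u)"
    if "u \<in> carrier M" "v \<in> carrier M" for u v
    using that by (simp add: kl l_distr r_distr a_ac)
qed

lemma quadratic_form_smult:
  assumes R: "cring R" and M: "module R M" and q: "quadratic_form R M q" and c: "c \<in> carrier R"
  shows "quadratic_form R M (\<lambda>x. c \<otimes>\<^bsub>R\<^esub> q x)"
proof (rule quadratic_formI[where b="\<lambda>u v. c \<otimes>\<^bsub>R\<^esub> polar_form R M q u v", OF R _ _ _ _ M])
  interpret cring R by fact
  interpret M: module R M by fact
  have qc: "q v \<in> carrier R" if "v \<in> carrier M" for v
    using q that by (auto simp: quadratic_form_def)
  have b: "polar_form R M q u v \<in> carrier R"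
    if "u \<in> carrier M" "v \<in> carrier M" for u v
    using q that by (auto simp: quadratic_form_def bilinear_form_def)
  show "(\<lambda>x. c \<otimes>\<^bsub>R\<^esub> q x) \<in> carrier M \<rightarrow> carrier R"
    using qc c by auto
  show "c \<otimes>\<^bsub>R\<^esub> q (a \<odot>\<^bsub>M\<^esub> v) = (a \<otimes>\<^bsub>R\<^esub> a) \<otimes>\<^bsub>R\<^esub> (c \<otimes>\<^bsub>R\<^esub> q v)"
    if "a \<in> carrier R" "v \<in> carrier M" for a v
    using q that by (simp add: quadratic_form_def m_ac qc c)
  show "bilinear_form R M (\<lambda>u v. c \<otimes>\<^bsub>R\<^esub> polar_form R M q u v)"
    using q unfolding quadratic_form_def bilinear_form_def
    by (simp add: r_distr b m_ac c)
  show "c \<otimes>\<^bsub>R\<^esub> q (u \<oplus>\<^bsub>M\<^esub> v) = (c \<otimes>\<^bsub>R\<^esub> q u \<oplus>\<^bsub>R\<^esub> c \<otimes>\<^bsub>R\<^esub> q v) \<oplus>\<^bsub>R\<^esub> c \<otimes>\<^bsub>R\<^esub> polar_form R M q u v"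
    if "u \<in> carrier M" "v \<in> carrier M" for u v
    using that by (simp add: quadratic_form_polar[OF R] q qc b c r_distr)
qed

section \<open>Free modules, and the values that determine functionals and forms on them\<close>

lemma free_module_simps:
  "\<zero>\<^bsub>free_module R S\<^esub> = (\<lambda>s. \<zero>\<^bsub>R\<^esub>)"
  "x \<oplus>\<^bsub>free_module R S\<^esub> y = (\<lambda>s. x s \<oplus>\<^bsub>R\<^esub> y s)"
  "a \<odot>\<^bsub>free_module R S\<^esub> x = (\<lambda>s. a \<otimes>\<^bsub>R\<^esub> x s)"
  by (simp_all add: free_module_def)

lemma free_module_carrier_iff:
  "x \<in> carrier (free_module R S) \<longleftrightarrow>
    (\<forall>s. x s \<in> carrier R) \<and> (\<forall>s. s \<notin> S \<longrightarrow> x s = \<zero>\<^bsub>R\<^esub>) \<and> finite {s. x s \<noteq> \<zero>\<^bsub>R\<^esub>}"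
  by (simp add: free_module_def)

context cring
begin

lemma free_module_add_closed:
  assumes "x \<in> carrier (free_module R S)" "y \<in> carrier (free_module R S)"
  shows "(\<lambda>s. x s \<oplus> y s) \<in> carrier (free_module R S)"
proof -
  have "{s. x s \<oplus> y s \<noteq> \<zero>} \<subseteq> {s. x s \<noteq> \<zero>} \<union> {s. y s \<noteq> \<zero>}" by auto
  then show ?thesis using assms by (auto simp: free_module_carrier_iff intro: finite_subset)
qed

lemma free_module_smult_closed:
  assumes "a \<in> carrier R" "x \<in> carrier (free_module R S)"
  shows "(\<lambda>s. a \<otimes> x s) \<in> carrier (free_module R S)"
proof -
  have "{s. a \<otimes> x s \<noteq> \<zero>} \<subseteq> {s. x s \<noteq> \<zero>}" using assms(1) by auto
  then show ?thesis using assms by (auto simp: free_module_carrier_iff intro: finite_subset)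
qed

lemma free_module_is_module: "module R (free_module R S)"
proof (rule module_criteria)
  show "cring R" by (rule is_cring)
  let ?M = "free_module R S"
  show "\<forall>v w. v \<in> carrier ?M \<and> w \<in> carrier ?M \<longrightarrow> v \<oplus>\<^bsub>?M\<^esub> w \<in> carrier ?M"
    by (simp add: free_module_simps free_module_add_closed)
  show "\<forall>c v. c \<in> carrier R \<and> v \<in> carrier ?M \<longrightarrow> c \<odot>\<^bsub>?M\<^esub> v \<in> carrier ?M"
    by (simp add: free_module_simps free_module_smult_closed)
  show "\<forall>v \<in> carrier ?M. (\<exists>w\<in>carrier ?M. v \<oplus>\<^bsub>?M\<^esub> w = \<zero>\<^bsub>?M\<^esub>)"
  proof
    fix v assume v: "v \<in> carrier ?M"
    show "\<exists>w\<in>carrier ?M. v \<oplus>\<^bsub>?M\<^esub> w = \<zero>\<^bsub>?M\<^esub>"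
      using free_module_smult_closed[OF _ v, of "\<ominus> \<one>"] v
      by (intro bexI[of _ "\<lambda>s. \<ominus> \<one> \<otimes> v s"])
         (auto simp: free_module_simps free_module_carrier_iff l_minus r_neg)
  qed
qed (auto simp: free_module_simps free_module_carrier_iff fun_eq_iff a_ac m_ac l_distr r_distr)

lemma free_gen_closed: "s \<in> S \<Longrightarrow> free_gen R s \<in> carrier (free_module R S)"
  by (auto simp: free_module_carrier_iff free_gen_def)

text \<open>Induction on the size of the support: setting one coordinate to zero splits off a
  multiple of one generator.\<close>

lemma free_module_induct [consumes 1, case_names zero add]:
  assumes x: "x \<in> carrier (free_module R S)"
    and zero: "P (\<lambda>s. \<zero>)"
    and add: "\<And>x a s. x \<in> carrier (free_module R S) \<Longrightarrow> P x \<Longrightarrow> a \<in> carrier R \<Longrightarrow> s \<in> S \<Longrightarrow>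
      P (x \<oplus>\<^bsub>free_module R S\<^esub> (a \<odot>\<^bsub>free_module R S\<^esub> free_gen R s))"
  shows "P x"
proof -
  have "finite {s. x s \<noteq> \<zero>}" using x by (simp add: free_module_carrier_iff)
  moreover have "finite A \<Longrightarrow> \<forall>x \<in> carrier (free_module R S). {s. x s \<noteq> \<zero>} = A \<longrightarrow> P x" for A
  proof (induction A rule: finite_induct)
    case empty
    then show ?case using zero by (auto simp: fun_eq_iff)
  next
    case (insert s A)
    show ?case
    proof (intro ballI impI)
      fix x assume x: "x \<in> carrier (free_module R S)" and sx: "{s. x s \<noteq> \<zero>} = insert s A"
      let ?y = "x(s := \<zero>)"
      have ys: "{s. ?y s \<noteq> \<zero>} = A" using sx insert.hyps by auto
      then have y: "?y \<in> carrier (free_module R S)"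
        using x insert.hyps(1) by (auto simp: free_module_carrier_iff simp del: fun_upd_apply) (auto)
      have s: "s \<in> S" using x sx by (auto simp: free_module_carrier_iff)
      have xs: "x s \<in> carrier R" using x by (simp add: free_module_carrier_iff)
      have "x = ?y \<oplus>\<^bsub>free_module R S\<^esub> (x s \<odot>\<^bsub>free_module R S\<^esub> free_gen R s)"
        using x by (auto simp: free_module_simps free_gen_def free_module_carrier_iff fun_eq_iff)
      then show "P x" using add[OF y _ xs s] insert.IH y ys by metis
    qed
  qed
  ultimately show ?thesis using x by blast
qed

lemma linear_functional_zero:
  assumes l: "linear_functional R (free_module R S) l"
    and "\<And>s. s \<in> S \<Longrightarrow> l (free_gen R s) = \<zero>" "x \<in> carrier (free_module R S)"
  shows "l x = \<zero>"
  using assms(3)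
proof (induction rule: free_module_induct)
  case zero
  interpret M: module R "free_module R S" by (rule free_module_is_module)
  have z: "(\<lambda>s. \<zero>) \<in> carrier (free_module R S)"
    using M.zero_closed by (simp add: free_module_simps)
  show ?case using linear_functionalD(3)[OF l zero_closed z] linear_functionalD(1)[OF l z]
    by (simp add: free_module_simps)
next
  case (add x a s)
  interpret M: module R "free_module R S" by (rule free_module_is_module)
  show ?case using add assms(2)[of s] free_gen_closed[of s S]
    by (simp add: linear_functionalD[OF l])
qed

text \<open>Generators alone do not determine a form; sums of two generators supply the polar form
  on pairs. The difference of \<open>p\<close> and \<open>q\<close> then has vanishing values and
  vanishing polar form on generators, hence is zero. This is the uniqueness behind
  \<open>scalar_ext_form\<close>.\<close>

lemma quadratic_form_eqI:
  assumes p: "quadratic_form R (free_module R S) p" and q: "quadratic_form R (free_module R S) q"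
    and gen: "\<And>s. s \<in> S \<Longrightarrow> p (free_gen R s) = q (free_gen R s)"
    and polar: "\<And>s t. s \<in> S \<Longrightarrow> t \<in> S \<Longrightarrow>
      p (free_gen R s \<oplus>\<^bsub>free_module R S\<^esub> free_gen R t) = q (free_gen R s \<oplus>\<^bsub>free_module R S\<^esub> free_gen R t)"
    and "x \<in> carrier (free_module R S)"
  shows "p x = q x"
proof -
  let ?M = "free_module R S"
  interpret M: module R ?M by (rule free_module_is_module)
  define d where "d = (\<lambda>x. p x \<oplus> (\<ominus> \<one>) \<otimes> q x)"
  have d: "quadratic_form R ?M d"
    unfolding d_def using is_cring M.module_axioms p q
    by (intro quadratic_form_add quadratic_form_smult) auto
  have pc: "p v \<in> carrier R" "q v \<in> carrier R" if "v \<in> carrier ?M" for v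
    using p q that by (auto simp: quadratic_form_def)
  have dg: "d (free_gen R s) = \<zero>" if "s \<in> S" for s
    using gen[OF that] pc[OF free_gen_closed[OF that]] by (simp add: d_def l_minus r_neg)
  have bg: "polar_form R ?M d (free_gen R s) (free_gen R t) = \<zero>" if "s \<in> S" "t \<in> S" for s t
    using that polar[OF that] pc[of "free_gen R s \<oplus>\<^bsub>?M\<^esub> free_gen R t"] free_gen_closed[of _ S]
    unfolding polar_form_def dg[OF that(1)] dg[OF that(2)] by (simp add: d_def l_minus r_neg)
  \<comment> \<open>Extending one slot suffices: the induction below adds one multiple of a
    generator at a time, so the other slot always holds a generator. Symmetry of the polar form
    brings it to the right side.\<close>
  have bx: "polar_form R ?M d (free_gen R s) x = \<zero>" if "s \<in> S" "x \<in> carrier ?M" for s x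
    by (rule linear_functional_zero[OF linear_functional_polar[OF d] bg])
       (use that free_gen_closed in auto)
  have "d x = \<zero>" using assms(5)
  proof (induction rule: free_module_induct)
    case zero
    have z: "(\<lambda>s. \<zero>) \<in> carrier ?M"
      using M.zero_closed by (simp add: free_module_simps)
    have "d (\<zero> \<odot>\<^bsub>?M\<^esub> (\<lambda>s. \<zero>)) = (\<zero> \<otimes> \<zero>) \<otimes> d (\<lambda>s. \<zero>)"
      using d z zero_closed unfolding quadratic_form_def by blast
    moreover have "d (\<lambda>s. \<zero>) \<in> carrier R"
      using d z by (auto simp: quadratic_form_def)
    ultimately show ?case by (simp add: free_module_simps)
  next
    case (add x a s)
    have g: "free_gen R s \<in> carrier ?M" using add by (simp add: free_gen_closed)
    have "d (x \<oplus>\<^bsub>?M\<^esub> (a \<odot>\<^bsub>?M\<^esub> free_gen R s)) = (d x \<oplus> d (a \<odot>\<^bsub>?M\<^esub> free_gen R s)) \<oplus> polar_form R ?M d x (a \<odot>\<^bsub>?M\<^esub> free_gen R s)"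
      using add g by (intro quadratic_form_polar[OF is_cring d]) auto
    also have "polar_form R ?M d x (a \<odot>\<^bsub>?M\<^esub> free_gen R s) = a \<otimes> polar_form R ?M d x (free_gen R s)"
      using linear_functionalD(3)[OF linear_functional_polar[OF d]] add g by auto
    also have "polar_form R ?M d x (free_gen R s) = polar_form R ?M d (free_gen R s) x"
    proof -
      have "d x \<in> carrier R" "d (free_gen R s) \<in> carrier R" 
           "d (free_gen R s \<oplus>\<^bsub>?M\<^esub> x) \<in> carrier R"
        using d add g by (auto simp: quadratic_form_def)
      then show ?thesis
        unfolding polar_form_def M.a_comm[OF \<open>x \<in> carrier ?M\<close> g] by algebra
    qed
    also have "d (a \<odot>\<^bsub>?M\<^esub> free_gen R s) = \<zero>"
      using d add g dg[of s] by (auto simp: quadratic_form_def)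
    finally show ?case using add bx[of s x] by simp
  qed
  then show ?thesis using pc[OF assms(5)] unfolding d_def
    by (metis l_minus l_one one_closed minus_equality minus_minus a_inv_closed a_comm)
qed

end

section \<open>Linear functionals and forms defined over a subfield\<close>

text \<open>A form or map counts as defined over \<open>K\<close> if it preserves \<open>T\<close>-rational points for every
  intermediate field \<open>T\<close>. This avoids coefficients and is all that the induction needs.\<close>

definition rational ::
    "('a, 'm) ring_scheme \<Rightarrow> 'a set \<Rightarrow> 's set \<Rightarrow> (('s \<Rightarrow> 'a) \<Rightarrow> 'a) \<Rightarrow> bool"
  where "rational R K S f \<longleftrightarrow>
    (\<forall>T. subfield T R \<longrightarrow> K \<subseteq> T \<longrightarrow> f \<in> carrier (free_module (R\<lparr>carrier := T\<rparr>) S) \<rightarrow> T)"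

definition rational_hom ::
    "('a, 'm) ring_scheme \<Rightarrow> 'a set \<Rightarrow> 's set \<Rightarrow> 't set \<Rightarrow> (('s \<Rightarrow> 'a) \<Rightarrow> 't \<Rightarrow> 'a) set"
  where "rational_hom R K S S' = {f \<in> module_hom R (free_module R S) (free_module R S').
    \<forall>T. subfield T R \<longrightarrow> K \<subseteq> T \<longrightarrow>
      f \<in> carrier (free_module (R\<lparr>carrier := T\<rparr>) S) \<rightarrow> carrier (free_module (R\<lparr>carrier := T\<rparr>) S')}"

lemma rationalD:
  "rational R K S f \<Longrightarrow> subfield T R \<Longrightarrow> K \<subseteq> T \<Longrightarrow>
    x \<in> carrier (free_module (R\<lparr>carrier := T\<rparr>) S) \<Longrightarrow> f x \<in> T"
  by (auto simp: rational_def)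

lemma rational_homD:
  assumes "f \<in> rational_hom R K S S'"
  shows "f \<in> module_hom R (free_module R S) (free_module R S')"
    and "subfield T R \<Longrightarrow> K \<subseteq> T \<Longrightarrow> x \<in> carrier (free_module (R\<lparr>carrier := T\<rparr>) S) \<Longrightarrow>
      f x \<in> carrier (free_module (R\<lparr>carrier := T\<rparr>) S')"
  using assms by (auto simp: rational_hom_def)

lemma rational_comp:
  "rational R K S' f \<Longrightarrow> M \<in> rational_hom R K S S' \<Longrightarrow> rational R K S (\<lambda>x. f (M x))"
  by (auto simp: rational_def rational_hom_def)

lemma rational_hom_comp:
  assumes "N \<in> rational_hom R K S' S''" "M \<in> rational_hom R K S S'"
  shows "(\<lambda>x. N (M x)) \<in> rational_hom R K S S''"
proof -
  have "(\<lambda>x. N (M x)) \<in> module_hom R (free_module R S) (free_module R S'')"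
    using rational_homD(1)[OF assms(1)] rational_homD(1)[OF assms(2)]
    unfolding module_hom_def by (simp add: Pi_iff)
  then show ?thesis using assms by (auto simp: rational_hom_def)
qed

lemma rational_hom_incl: "S' \<subseteq> S \<Longrightarrow> (\<lambda>x. x) \<in> rational_hom R K S' S"
  by (auto simp: rational_hom_def module_hom_def free_module_carrier_iff) (auto simp: free_module_simps)

lemma free_module_subfield_mono:
  "T \<subseteq> T' \<Longrightarrow> S \<subseteq> S' \<Longrightarrow> x \<in> carrier (free_module (R\<lparr>carrier := T\<rparr>) S) \<Longrightarrow>
    x \<in> carrier (free_module (R\<lparr>carrier := T'\<rparr>) S')"
  by (auto simp: free_module_carrier_iff)

lemma free_module_subfield_subset:
  "T \<subseteq> carrier R \<Longrightarrow> x \<in> carrier (free_module (R\<lparr>carrier := T\<rparr>) S) \<Longrightarrow> x \<in> carrier (free_module R S)"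
  by (auto simp: free_module_carrier_iff)

lemma free_gen_subfield:
  "subfield T R \<Longrightarrow> s \<in> S \<Longrightarrow> free_gen R s \<in> carrier (free_module (R\<lparr>carrier := T\<rparr>) S)"
  using subfieldE(1)[of T R] by (auto simp: free_module_carrier_iff free_gen_def dest: subringE)

context field
begin

lemma free_module_subfield_add:
  assumes "subfield T R" "x \<in> carrier (free_module (R\<lparr>carrier := T\<rparr>) S)"
    "y \<in> carrier (free_module (R\<lparr>carrier := T\<rparr>) S)"
  shows "x \<oplus>\<^bsub>free_module R S\<^esub> y \<in> carrier (free_module (R\<lparr>carrier := T\<rparr>) S)"
proof -
  interpret T: field "R\<lparr>carrier := T\<rparr>" using subfield_iff(2)[OF assms(1)] .
  show ?thesis using T.free_module_add_closed[OF assms(2,3)] by (simp add: free_module_simps)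
qed

lemma free_module_subfield_smult:
  assumes "subfield T R" "a \<in> T" "x \<in> carrier (free_module (R\<lparr>carrier := T\<rparr>) S)"
  shows "a \<odot>\<^bsub>free_module R S\<^esub> x \<in> carrier (free_module (R\<lparr>carrier := T\<rparr>) S)"
proof -
  interpret T: field "R\<lparr>carrier := T\<rparr>" using subfield_iff(2)[OF assms(1)] .
  show ?thesis using T.free_module_smult_closed[OF _ assms(3)] assms(2) by (simp add: free_module_simps)
qed

lemma subfield_closed:
  assumes "subfield T R"
  shows "a \<in> T \<Longrightarrow> b \<in> T \<Longrightarrow> a \<oplus> b \<in> T" "a \<in> T \<Longrightarrow> b \<in> T \<Longrightarrow> a \<otimes> b \<in> T" "a \<in> T \<Longrightarrow> \<ominus> a \<in> T"
    "a \<in> T \<Longrightarrow> b \<in> T \<Longrightarrow> a \<ominus> b \<in> T" "\<zero> \<in> T" "\<one> \<in> T" "a \<in> T \<Longrightarrow> a \<in> carrier R"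
    "a \<in> T \<Longrightarrow> a \<noteq> \<zero> \<Longrightarrow> inv a \<in> T"
  using subringE[OF subfieldE(1)[OF assms]] subfield_m_inv(1)[OF assms] by (auto simp: a_minus_def)

lemma rational_polar:
  assumes "subfield K R" "rational R K S q" "e \<in> carrier (free_module (R\<lparr>carrier := K\<rparr>) S)"
  shows "rational R K S (polar_form R (free_module R S) q e)"
  unfolding rational_def
proof (intro allI impI funcsetI)
  fix T x assume T: "subfield T R" "K \<subseteq> T" and x: "x \<in> carrier (free_module (R\<lparr>carrier := T\<rparr>) S)"
  have e: "e \<in> carrier (free_module (R\<lparr>carrier := T\<rparr>) S)"
    using free_module_subfield_mono[OF T(2) order_refl assms(3)] .
  show "polar_form R (free_module R S) q e x \<in> T"
    unfolding polar_form_def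
    by (intro subfield_closed[OF T(1)] rationalD[OF assms(2) T] free_module_subfield_add e x T(1))
qed

text \<open>If \<open>l e\<^sub>p \<noteq> 0\<close>, then \<open>x - (l x / l e\<^sub>p) e\<^sub>p\<close> lies in the kernel of \<open>l\<close>. The other coordinates are
  unchanged, so this map is injective on the vectors without \<open>p\<close>-coordinate, over every extension field.\<close>

lemma eliminate_functional:
  assumes K: "subfield K R" and S: "finite S" "S \<noteq> {}"
    and l: "linear_functional R (free_module R S) l" and lK: "rational R K S l"
  shows "\<exists>p \<in> S. \<exists>M \<in> rational_hom R K (S - {p}) S. \<forall>x \<in> carrier (free_module R (S - {p})).
    l (M x) = \<zero> \<and> (\<forall>s \<in> S - {p}. M x s = x s)"
proof (cases "\<forall>s \<in> S. l (free_gen R s) = \<zero>")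
  case True
  \<comment> \<open>Here \<open>l\<close> is zero and imposes no condition. A coordinate is dropped
    all the same, so that every functional costs exactly one.\<close>
  obtain p where "p \<in> S" using S by auto
  moreover have "l x = \<zero>" if "x \<in> carrier (free_module R (S - {p}))" for x
    using linear_functional_zero[OF l] True that by (auto simp: free_module_carrier_iff)
  ultimately show ?thesis using rational_hom_incl[of "S - {p}" S R K]
    by (intro bexI[of _ p] bexI[of _ "\<lambda>x. x"]) auto
next
  case False
  then obtain p where p: "p \<in> S" "l (free_gen R p) \<noteq> \<zero>" by auto
  let ?V = "free_module R S" and ?W = "free_module R (S - {p})"
  interpret V: module R ?V by (rule free_module_is_module)
  interpret W: module R ?W by (rule free_module_is_module)
  \<comment> \<open>The sign is absorbed into \<open>c\<close>. As \<open>l\<close> is rational over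
    \<open>K\<close>, \<open>c\<close> lies in \<open>K\<close>, which makes \<open>M\<close>
    rational over \<open>K\<close> too.\<close>
  define c where "c = \<ominus> (inv (l (free_gen R p)))"
  have g: "free_gen R p \<in> carrier ?V" using p by (simp add: free_gen_closed)
  have lg: "l (free_gen R p) \<in> K"
    using rationalD[OF lK K order_refl free_gen_subfield[OF K p(1)]] .
  then have cK: "c \<in> K" unfolding c_def using p(2) K by (intro subfield_closed) 
  then have c: "c \<in> carrier R" using subfield_closed[OF K] by auto
  have lgR: "l (free_gen R p) \<in> carrier R" using lg subfield_closed[OF K] by auto
  have clg: "c \<otimes> l (free_gen R p) = \<ominus> \<one>"
    unfolding c_def using p(2) lgR by (simp add: l_minus field_Units)
  define M where "M = (\<lambda>x. x \<oplus>\<^bsub>?V\<^esub> ((c \<otimes> l x) \<odot>\<^bsub>?V\<^esub> free_gen R p))"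
  have sub: "x \<in> carrier ?V" if "x \<in> carrier ?W" for x
    using that by (auto simp: free_module_carrier_iff)
  note ll = linear_functionalD[OF l]
  have "M \<in> module_hom R ?W ?V"
    unfolding module_hom_def
  proof (intro CollectI conjI allI impI)
    show "M \<in> carrier ?W \<rightarrow> carrier ?V" using sub g ll c by (auto simp: M_def)
    show "M (u \<oplus>\<^bsub>?W\<^esub> v) = M u \<oplus>\<^bsub>?V\<^esub> M v" if "u \<in> carrier ?W \<and> v \<in> carrier ?W" for u v
    proof -
      have "u \<oplus>\<^bsub>?W\<^esub> v = u \<oplus>\<^bsub>?V\<^esub> v" by (simp add: free_module_simps)
      then show ?thesis using that sub g ll c
        by (simp add: M_def r_distr V.smult_l_distr V.a_ac)
    qed
    show "M (a \<odot>\<^bsub>?W\<^esub> v) = a \<odot>\<^bsub>?V\<^esub> M v" if "a \<in> carrier R \<and> v \<in> carrier ?W" for a v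
    proof -
      have "a \<odot>\<^bsub>?W\<^esub> v = a \<odot>\<^bsub>?V\<^esub> v" by (simp add: free_module_simps)
      then show ?thesis using that sub g ll c
        by (simp add: M_def V.smult_r_distr V.smult_assoc1[symmetric] m_lcomm)
    qed
  qed
  moreover have "M x \<in> carrier (free_module (R\<lparr>carrier := T\<rparr>) S)"
    if "subfield T R" "K \<subseteq> T" "x \<in> carrier (free_module (R\<lparr>carrier := T\<rparr>) (S - {p}))" for T x
  proof -
    have x: "x \<in> carrier (free_module (R\<lparr>carrier := T\<rparr>) S)"
      using free_module_subfield_mono[OF order_refl _ that(3)] by auto
    show ?thesis unfolding M_def
      using rationalD[OF lK that(1,2) x] cK that(2)
      by (intro free_module_subfield_add free_module_subfield_smult free_gen_subfield
          subfield_closed that x p) auto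
  qed
  ultimately have "M \<in> rational_hom R K (S - {p}) S" by (auto simp: rational_hom_def)
  moreover have "l (M x) = \<zero>" if "x \<in> carrier ?W" for x
  proof -
    have "l (M x) = l x \<oplus> l x \<otimes> (c \<otimes> l (free_gen R p))"
      using sub[OF that] g ll c by (simp add: M_def m_ac)
    then show ?thesis using ll(1)[OF sub[OF that]] by (simp add: clg r_minus r_neg)
  qed
  moreover have "M x s = x s" if "x \<in> carrier ?W" "s \<in> S - {p}" for x s
    using that ll(1)[OF sub[OF that(1)]] c
    by (auto simp: M_def free_module_simps free_gen_def free_module_carrier_iff)
  ultimately show ?thesis using p by blast
qed

text \<open>Each further functional is pulled back along the parametrisation \<open>M\<close> found
  so far and eliminated among the remaining coordinates. As the surviving coordinates are never
  altered, the composite stays injective over every extension field.\<close>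

lemma eliminate_functionals:
  assumes K: "subfield K R" and S: "finite S" and "length ls \<le> card S"
    and "\<And>l. l \<in> set ls \<Longrightarrow> linear_functional R (free_module R S) l \<and> rational R K S l"
  shows "\<exists>S' M. S' \<subseteq> S \<and> card S' + length ls = card S \<and> M \<in> rational_hom R K S' S \<and>
    (\<forall>x \<in> carrier (free_module R S'). (\<forall>l \<in> set ls. l (M x) = \<zero>) \<and> (\<forall>s \<in> S'. M x s = x s))"
  using assms(3,4)
proof (induction ls)
  case Nil
  then show ?case using rational_hom_incl[of S S R K] by auto
next
  case (Cons l ls)
  then obtain S' M where M: "S' \<subseteq> S" "card S' + length ls = card S" "M \<in> rational_hom R K S' S"
    and Mx: "\<And>x l. x \<in> carrier (free_module R S') \<Longrightarrow> l \<in> set ls \<Longrightarrow> l (M x) = \<zero>"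
      "\<And>x s. x \<in> carrier (free_module R S') \<Longrightarrow> s \<in> S' \<Longrightarrow> M x s = x s"
    by (metis (no_types, lifting) Suc_leD length_Cons list.set_intros(2))
  \<comment> \<open>The bound on the number of functionals leaves at least one coordinate to
    eliminate.\<close>
  have S': "finite S'" "S' \<noteq> {}" using M Cons.prems(1) S finite_subset by auto
  have l: "linear_functional R (free_module R S') (\<lambda>x. l (M x))" "rational R K S' (\<lambda>x. l (M x))"
    using Cons.prems(2)[of l] linear_functional_comp[OF _ rational_homD(1)[OF M(3)]]
      rational_comp[OF _ M(3)] by simp_all
  obtain p N where p: "p \<in> S'" and N: "N \<in> rational_hom R K (S' - {p}) S'"
    and Nx: "\<And>x. x \<in> carrier (free_module R (S' - {p})) \<Longrightarrow> l (M (N x)) = \<zero>"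
      "\<And>x s. x \<in> carrier (free_module R (S' - {p})) \<Longrightarrow> s \<in> S' - {p} \<Longrightarrow> N x s = x s"
    using eliminate_functional[OF K S' l] by blast
  have Nc: "N x \<in> carrier (free_module R S')" if "x \<in> carrier (free_module R (S' - {p}))" for x
    using rational_homD(1)[OF N] that by (auto simp: module_hom_def)
  have "card (S' - {p}) + length (l # ls) = card S"
    using M(2) card_Suc_Diff1[OF S'(1) p] by simp
  moreover have "S' - {p} \<subseteq> S" using M(1) by auto
  ultimately show ?case using rational_hom_comp[OF M(3) N] Nx Mx[OF Nc]
    by (intro exI[of _ "S' - {p}"] exI[of _ "\<lambda>x. M (N x)"]) auto
qed

end

section \<open>Common zeros in towers of quadratic extensions\<close>

text \<open>Towers grow at the top, as the induction on forms requires; the index counts the steps.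
  The indexed chain of intermediate fields is recovered in
  \<open>quadratic_tower_sequence\<close>.\<close>

inductive (in ring) quadratic_tower :: "'a set \<Rightarrow> nat \<Rightarrow> 'a set \<Rightarrow> bool" for K where
  quadratic_tower_base: "quadratic_tower K 0 K"
| quadratic_tower_step: "quadratic_tower K n L \<Longrightarrow> subfield M R \<Longrightarrow> L \<subseteq> M \<Longrightarrow> dimension 2 L M \<Longrightarrow>
    quadratic_tower K (Suc n) M"

lemma (in ring) quadratic_tower_subfield:
  assumes "quadratic_tower K n L" "subfield K R"
  shows "subfield L R" "K \<subseteq> L"
  using assms by (induction rule: quadratic_tower.induct) auto

text \<open>A root \<open>a\<close> exists in the closure. If it lies outside \<open>T\<close>, its
  minimal polynomial divides the quadratic and cannot be linear, so \<open>a\<close> generates an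
  extension of degree exactly 2. The alternative \<open>M = T\<close> is why a form may cost no step
  at all.\<close>

lemma (in algebraically_closed) adjoin_quadratic_root:
  assumes T: "subfield T L" and c: "c2 \<in> T" "c1 \<in> T" "c0 \<in> T" "c2 \<noteq> \<zero>"
  shows "\<exists>a M. subfield M L \<and> T \<subseteq> M \<and> a \<in> M \<and> (a \<otimes> a) \<otimes> c2 \<oplus> a \<otimes> c1 \<oplus> c0 = \<zero> \<and>
    (M = T \<or> dimension 2 T M)"
proof -
  let ?p = "[c2, c1, c0]"
  have sub: "T \<subseteq> carrier L" using subfieldE(3)[OF T] .
  have pT: "?p \<in> carrier (T[X])"
    using c by (auto simp: univ_poly_def polynomial_def)
  have pL: "?p \<in> carrier (poly_ring L)"
    using c sub by (auto simp: univ_poly_def polynomial_def)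
  have "size (roots ?p) = 2" using roots_over_carrier[OF pL] by (simp add: splitted_def)
  then obtain a where "a \<in># roots ?p" by (metis multiset_nonemptyE size_empty zero_neq_numeral)
  then have a: "a \<in> carrier L" "eval ?p a = \<zero>"
    using roots_mem_iff_is_root[OF pL] by (auto simp: is_root_def)
  have eq: "(a \<otimes> a) \<otimes> c2 \<oplus> a \<otimes> c1 \<oplus> c0 = \<zero>"
    using a c sub by (auto simp: numeral_eq_Suc m_ac a_ac subset_iff)
  show ?thesis
  proof (cases "a \<in> T")
    case True
    then show ?thesis using T eq by blast
  next
    case False
    have alg: "(algebraic over T) a" using algebraicI[OF pT _ a(2)] by simp
    let ?M = "simple_extension T a"
    have M: "subfield ?M L" using simple_extension_is_subfield[OF T a(1)] alg by simp
    have TM: "T \<subseteq> ?M" by (rule simple_extension_incl[OF sub a(1)])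
    have aM: "a \<in> ?M" by (rule simple_extension_mem[OF subfieldE(1)[OF T] a(1)])
    have dim: "dimension (degree (Irr T a)) T ?M" by (rule dimension_simple_extension[OF T a(1) alg])
    note irr = IrrE[OF T a(1) alg]
    have "(Irr T a) pdivides ?p" by (rule Irr_minimal[OF T a(1) alg pT a(2)])
    then have "degree (Irr T a) \<le> 2"
      using pdivides_imp_degree_le[OF subfieldE(1)[OF T] irr(1) pT] by auto
    moreover have "degree (Irr T a) \<noteq> 0"
    proof
      assume "degree (Irr T a) = 0"
      then have "dimension 0 T ?M" using dim by simp
      then have "?M = {\<zero>}" by (rule dimension_zero[OF T])
      then show False using aM False subfield_closed(5)[OF T] by simp
    qed
    moreover have "degree (Irr T a) \<noteq> 1"
    proof
      assume d: "degree (Irr T a) = 1"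
      \<comment> \<open>Polynomials are coefficient lists with the leading coefficient in front; a
        monic linear one is X + b, with root -b in \<open>T\<close>.\<close>
      then obtain k b where kb: "Irr T a = [k, b]"
        by (cases "Irr T a"; cases "tl (Irr T a)") auto
      then have "k = \<one>" "b \<in> T"
        using irr(1,3) by (auto simp: univ_poly_def polynomial_def)
      then have "a \<oplus> b = \<zero>" using irr(4) kb a(1) sub by auto
      then have "a = \<ominus> b" using \<open>b \<in> T\<close> a(1) sub by (metis minus_equality subsetD)
      then have "a \<in> T" using \<open>b \<in> T\<close> subfield_closed(3)[OF T] by simp
      then show False using False by simp
    qed
    ultimately have "degree (Irr T a) = 2" by linarith
    then show ?thesis using M TM aM eq dim by metis
  qed
qed

lemma (in algebraically_closed) common_zero_in_quadratic_tower:
  assumes K: "subfield K L" and "finite S" "length qs * (length qs + 1) div 2 + 1 \<le> card S"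
    and "\<And>q. q \<in> set qs \<Longrightarrow> quadratic_form L (free_module L S) q \<and> rational L K S q"
  shows "\<exists>n M x. n \<le> length qs \<and> quadratic_tower K n M \<and>
    x \<in> carrier (free_module (L\<lparr>carrier := M\<rparr>) S) \<and> x \<noteq> (\<lambda>s. \<zero>) \<and> (\<forall>q \<in> set qs. q x = \<zero>)"
  using assms(2-)
proof (induction "length qs" arbitrary: qs S rule: less_induct)
  case less
  note S = less.prems(1) and qs = less.prems(3)
  let ?V = "free_module L S"
  interpret V: module L ?V by (rule free_module_is_module)
  obtain e where e: "e \<in> S" using less.prems(2) by (cases "S = {}") auto
  let ?g = "free_gen L e"
  have g: "?g \<in> carrier ?V" "?g \<in> carrier (free_module (L\<lparr>carrier := K\<rparr>) S)"
    using e free_gen_subfield[OF K] by (auto simp: free_gen_closed)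
  have gz: "?g \<noteq> (\<lambda>s. \<zero>)" by (auto simp: free_gen_def fun_eq_iff intro!: exI[of _ e])
  show ?case
  \<comment> \<open>The empty list falls under the first case vacuously, so this is also the base of
    the strong induction.\<close>
  proof (cases "\<forall>q \<in> set qs. q ?g = \<zero>")
    case True
    then show ?thesis using g(2) gz quadratic_tower_base[of K] by blast
  next
    case False
    then obtain p where p: "p \<in> set qs" "p ?g \<noteq> \<zero>" by auto
    \<comment> \<open>\<open>remove1\<close> deletes a single occurrence, so the length drops by
      exactly one even if \<open>p\<close> is repeated in the list.\<close>
    define qs' where "qs' = remove1 p qs"
    have setqs: "set qs \<subseteq> insert p (set qs')" "set qs' \<subseteq> set qs"
      by (auto simp: qs'_def in_set_remove1 set_remove1_subset)
        (metis in_set_remove1)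
    have len: "length qs = Suc (length qs')"
      using p length_pos_if_in_set[OF p(1)] by (simp add: qs'_def length_remove1)
    have pq: "quadratic_form L ?V p" "rational L K S p" using qs[OF p(1)] by auto
    have pgK: "p ?g \<in> K" using rationalD[OF pq(2) K order_refl g(2)] .
    \<comment> \<open>The multiple of \<open>p\<close> that cancels the value of \<open>q\<close> at
      \<open>e\<close>. It lies in \<open>K\<close>, so the corrected forms \<open>t q\<close> stay
      rational over \<open>K\<close>.\<close>
    define c where "c q = \<ominus> (q ?g \<otimes> inv (p ?g))" for q
    define t where "t q x = q x \<oplus> c q \<otimes> p x" for q x
    have cK: "c q \<in> K" if "q \<in> set qs" for q
      unfolding c_def using qs[OF that] rationalD[of L K S q K ?g] K g(2) pgK p(2)
      by (intro subfield_closed[OF K]) auto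
    have cL: "c q \<in> carrier L" if "q \<in> set qs" for q
      using cK[OF that] subfield_closed(7)[OF K] by auto
    have tq: "quadratic_form L ?V (t q)" if "q \<in> set qs" for q
      using quadratic_form_add[OF is_cring V.module_axioms _ quadratic_form_smult[OF is_cring V.module_axioms pq(1) cL[OF that]]]
        qs[OF that] unfolding t_def[abs_def] by blast
    have tK: "rational L K S (t q)" if "q \<in> set qs" for q
      unfolding rational_def
    proof (intro allI impI funcsetI)
      fix T x assume T: "subfield T L" "K \<subseteq> T" and x: "x \<in> carrier (free_module (L\<lparr>carrier := T\<rparr>) S)"
      show "t q x \<in> T" unfolding t_def
        using cK[OF that] T(2) rationalD[OF pq(2) T x] rationalD[OF conjunct2[OF qs[OF that]] T x]
        by (intro subfield_closed[OF T(1)]) auto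
    qed
    have tg: "t q ?g = \<zero>" if "q \<in> set qs" for q
    proof -
      have "q ?g \<in> carrier L" "p ?g \<in> carrier L"
        using qs[OF that] pq g(1) by (auto simp: quadratic_form_def)
      then show ?thesis using p(2)
        by (simp add: t_def c_def l_minus m_assoc field_Units r_neg)
    qed
    \<comment> \<open>Leaving out the coordinate \<open>e\<close> keeps the vector found below
      independent of \<open>e\<close>. The functionals express orthogonality to \<open>e\<close> for
      the corrected forms, one for each member of \<open>qs'\<close>.\<close>
    let ?S0 = "S - {e}"
    let ?ls = "map (\<lambda>q. polar_form L ?V (t q) ?g) qs'"
    \<comment> \<open>Doubling removes \<open>div\<close>, since a product of consecutive numbers is
      even. The triangular numbers then differ by \<open>length qs' + 1\<close>: one dimension for
      \<open>e\<close> and one for each orthogonality condition.\<close>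
    have "2 * (length qs * (length qs + 1) div 2) = length qs * (length qs + 1)" by simp
    moreover have "2 * (length qs' * (length qs' + 1) div 2) = length qs' * (length qs' + 1)" by simp
    ultimately have arith: "length qs * (length qs + 1) div 2 = length qs' * (length qs' + 1) div 2 + length qs' + 1"
      unfolding len by simp
    have c0: "card ?S0 = card S - 1" using e S by simp
    have ls: "linear_functional L (free_module L ?S0) l \<and> rational L K ?S0 l" if l: "l \<in> set ?ls" for l
    proof -
      have inc: "(\<lambda>x. x) \<in> rational_hom L K ?S0 S" by (rule rational_hom_incl) auto
      obtain q where q: "q \<in> set qs'" "l = polar_form L ?V (t q) ?g" using l by auto
      then have "linear_functional L ?V l" "rational L K S l"
        using linear_functional_polar[OF tq g(1), of q] rational_polar[OF K tK g(2), of q] setqs(2) by auto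
      then show ?thesis
        using linear_functional_comp[OF _ rational_homD(1)[OF inc]] rational_comp[OF _ inc] by simp
    qed
    have "length ?ls \<le> card ?S0" using less.prems(2) arith c0 by simp
    from eliminate_functionals[OF K finite_Diff[OF S] this ls]
    obtain S' M where S': "S' \<subseteq> ?S0" "card S' + length ?ls = card ?S0"
      and M: "M \<in> rational_hom L K S' ?S0"
      and Ml: "\<And>x l. x \<in> carrier (free_module L S') \<Longrightarrow> l \<in> set ?ls \<Longrightarrow> l (M x) = \<zero>"
      and Mx: "\<And>x s. x \<in> carrier (free_module L S') \<Longrightarrow> s \<in> S' \<Longrightarrow> M x s = x s"
      by blast
    have M': "M \<in> rational_hom L K S' S"
      using rational_hom_comp[OF rational_hom_incl[of ?S0 S] M] by auto
    \<comment> \<open>The recursive call sees the corrected forms in the coordinates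
      \<open>S'\<close> of the orthogonal subspace, still over the same base field
      \<open>K\<close>.\<close>
    define qs'' where "qs'' = map (\<lambda>q x. t q (M x)) qs'"
    have "length qs'' < length qs" by (simp add: qs''_def len)
    moreover have "finite S'" using S'(1) S finite_subset by blast
    moreover have "length qs'' * (length qs'' + 1) div 2 + 1 \<le> card S'"
      using less.prems(2) S'(2) arith c0 by (simp add: qs''_def)
    moreover have "quadratic_form L (free_module L S') q \<and> rational L K S' q" if q: "q \<in> set qs''" for q
    proof -
      obtain q' where q': "q' \<in> set qs" "q = (\<lambda>x. t q' (M x))" using q setqs(2) by (auto simp: qs''_def)
      show ?thesis unfolding q'(2)
        using quadratic_form_comp[OF is_cring free_module_is_module tq[OF q'(1)] rational_homD(1)[OF M']]
          rational_comp[OF tK[OF q'(1)] M'] by simp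
    qed
    ultimately obtain n T y where n: "n \<le> length qs''" and T: "quadratic_tower K n T"
      and y: "y \<in> carrier (free_module (L\<lparr>carrier := T\<rparr>) S')" "y \<noteq> (\<lambda>s. \<zero>)"
        "\<And>q. q \<in> set qs'' \<Longrightarrow> q y = \<zero>"
      using less.hyps[of qs'' S'] by blast
    have T': "subfield T L" "K \<subseteq> T" using quadratic_tower_subfield[OF T K] by auto
    have yL: "y \<in> carrier (free_module L S')"
      using free_module_subfield_subset[OF subfieldE(3)[OF T'(1)] y(1)] .
    define w where "w = M y"
    have w0: "w \<in> carrier (free_module (L\<lparr>carrier := T\<rparr>) ?S0)"
      unfolding w_def by (rule rational_homD(2)[OF M T' y(1)])
    have wT: "w \<in> carrier (free_module (L\<lparr>carrier := T\<rparr>) S)"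
      by (rule free_module_subfield_mono[OF _ _ w0]) auto
    have w: "w \<in> carrier ?V"
      using free_module_subfield_subset[OF subfieldE(3)[OF T'(1)] wT] .
    obtain s where s: "y s \<noteq> \<zero>" using y(2) by auto
    then have sS': "s \<in> S'" using yL by (auto simp: free_module_carrier_iff)
    \<comment> \<open>\<open>M\<close> preserves the coordinates in \<open>S'\<close>, a set
      avoiding \<open>e\<close>. The nonzero coordinate \<open>s\<close> therefore survives in
      \<open>w\<close>, and later in a e + w.\<close>
    then have ws: "w s \<noteq> \<zero>" "s \<noteq> e" using s Mx[OF yL] S'(1) by (auto simp: w_def)
    have gT: "?g \<in> carrier (free_module (L\<lparr>carrier := T\<rparr>) S)"
      by (rule free_gen_subfield[OF T'(1) e])
    have pw: "p w \<in> T" "p ?g \<in> T" "polar_form L ?V p ?g w \<in> T"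
      using rationalD[OF pq(2) T' wT] rationalD[OF pq(2) T' gT]
        rationalD[OF rational_polar[OF K pq(2) g(2)] T' wT] by auto
    \<comment> \<open>The equation is \<open>p\<close> evaluated at a e + w; its leading coefficient
      is the nonzero value of \<open>p\<close> at \<open>e\<close>.\<close>
    obtain a T1 where T1: "subfield T1 L" "T \<subseteq> T1" "a \<in> T1" "T1 = T \<or> dimension 2 T T1"
      and a: "(a \<otimes> a) \<otimes> p ?g \<oplus> a \<otimes> polar_form L ?V p ?g w \<oplus> p w = \<zero>"
      using adjoin_quadratic_root[OF T'(1) pw(2,3,1) p(2)] by blast
    have aL: "a \<in> carrier L" using T1 subfield_closed(7) by auto
    define x where "x = (a \<odot>\<^bsub>?V\<^esub> ?g) \<oplus>\<^bsub>?V\<^esub> w"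
    have xT: "x \<in> carrier (free_module (L\<lparr>carrier := T1\<rparr>) S)"
      unfolding x_def using free_module_subfield_mono[OF T1(2) order_refl] wT gT T1
      by (intro free_module_subfield_add free_module_subfield_smult) auto
    have x: "x \<in> carrier ?V" using aL g w by (simp add: x_def)
    have qx: "q x = ((a \<otimes> a) \<otimes> q ?g \<oplus> a \<otimes> polar_form L ?V q ?g w) \<oplus> q w"
      if q: "quadratic_form L ?V q" for q
    proof -
      have "polar_form L ?V q (a \<odot>\<^bsub>?V\<^esub> ?g) w = a \<otimes> polar_form L ?V q ?g w"
        using q aL g w by (simp add: quadratic_form_def bilinear_form_def)
      moreover have "q (a \<odot>\<^bsub>?V\<^esub> ?g) = (a \<otimes> a) \<otimes> q ?g"
        using q aL g by (simp add: quadratic_form_def)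
      moreover have "polar_form L ?V q ?g w \<in> carrier L" "q ?g \<in> carrier L" "q w \<in> carrier L"
        using q aL g w by (auto simp: quadratic_form_def bilinear_form_def)
      ultimately show ?thesis
        using quadratic_form_polar[OF is_cring q, of "a \<odot>\<^bsub>?V\<^esub> ?g" w] aL g w
        by (simp add: x_def a_ac)
    qed
    have px: "p x = \<zero>" using qx[OF pq(1)] a by simp
    have "q x = \<zero>" if "q \<in> set qs" for q
    proof (cases "q = p")
      case False
      then have q': "q \<in> set qs'" using that setqs by auto
      have "polar_form L ?V (t q) ?g w = \<zero>" using Ml[OF yL] q' by (simp add: w_def)
      moreover have "t q w = \<zero>" using y(3)[of "\<lambda>x. t q (M x)"] q' by (simp add: qs''_def w_def)
      \<comment> \<open>All three terms in the expansion of \<open>t q\<close> at a e + w vanish,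
        whatever \<open>a\<close> is. As \<open>q\<close> differs from \<open>t q\<close> by a
        multiple of \<open>p\<close>, it vanishes at \<open>x\<close> as well.\<close>
      ultimately have "t q x = \<zero>" using qx[OF tq[OF that]] tg[OF that] aL by simp
      moreover have "q x \<in> carrier L" using qs[OF that] x by (auto simp: quadratic_form_def)
      ultimately show ?thesis using cL[OF that] by (simp add: t_def px)
    qed (use px in simp)
    moreover have "x s = w s"
      using ws aL w by (simp add: x_def free_module_simps free_gen_def free_module_carrier_iff)
    then have "x \<noteq> (\<lambda>s. \<zero>)" using ws by auto
    moreover have "\<exists>m \<le> length qs. quadratic_tower K m T1"
    proof (cases "T1 = T")
      case True
      then show ?thesis using T n by (intro exI[of _ n]) (simp add: qs''_def len)
    next
      case False
      then have "quadratic_tower K (Suc n) T1" using quadratic_tower_step[OF T T1(1,2)] T1(4) by simp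
      then show ?thesis using n by (intro exI[of _ "Suc n"]) (simp add: qs''_def len)
    qed
    ultimately show ?thesis using xT by blast
  qed
qed

section \<open>Towers as generalized 2-extensions\<close>

text \<open>\<open>dimension\<close> refers to the ambient ring, and each new basis vector has to
  come from its carrier. The vector \<open>v\<close> does lie in \<open>T\<close>, because the line
  extension it spans contains 1 v + 0 and is contained in \<open>T\<close>; likewise 0 v + u for the
  earlier stage.\<close>

lemma (in ring) dimension_restrict_carrier:
  assumes "subfield T R" "subfield K R" "dimension n K E" "E \<subseteq> T"
  shows "ring.dimension (R\<lparr>carrier := T\<rparr>) n K E"
  using assms(3,2,4)
proof (induction rule: dimension.induct)
  interpret T: ring "R\<lparr>carrier := T\<rparr>"
    using subring_is_ring[OF subfieldE(1)[OF assms(1)]] .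
  case (zero_dim K)
  show ?case using T.zero_dim[of K] by simp
next
  interpret T: ring "R\<lparr>carrier := T\<rparr>"
    using subring_is_ring[OF subfieldE(1)[OF assms(1)]] .
  case (Suc_dim v E n K)
  have K: "\<zero> \<in> K" "\<one> \<in> K" using subringE[OF subfieldE(1)[OF Suc_dim.prems(1)]] by auto
  have E: "\<zero> \<in> E" "E \<subseteq> carrier R"
    using space_subgroup_props[OF Suc_dim.prems(1) Suc_dim.hyps(3)] by auto
  have "\<one> \<otimes> v \<oplus> \<zero> \<in> line_extension K v E"
    unfolding line_extension_mem_iff using K E by blast
  then have v: "v \<in> T" using Suc_dim by auto
  have "E \<subseteq> line_extension K v E"
  proof
    fix u assume "u \<in> E"
    then have "u = \<zero> \<otimes> v \<oplus> u" using E Suc_dim.hyps(1) by auto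
    then show "u \<in> line_extension K v E"
      unfolding line_extension_mem_iff using K \<open>u \<in> E\<close> by blast
  qed
  then have "E \<subseteq> T" using Suc_dim.prems(2) by auto
  then have "T.dimension n K E" by (rule Suc_dim.IH[OF Suc_dim.prems(1)])
  then have "T.dimension (Suc n) K (T.line_extension K v E)"
    using v Suc_dim.hyps(2) by (intro T.Suc_dim) auto
  then show ?case by (simp add: line_extension_consistent[OF subfieldE(1)[OF assms(1)]])
qed

lemma (in ring) subfield_restrict_carrier:
  assumes "subfield T R" "subfield K R" "K \<subseteq> T"
  shows "subfield K (R\<lparr>carrier := T\<rparr>)"
proof -
  interpret T: ring "R\<lparr>carrier := T\<rparr>"
    using subring_is_ring[OF subfieldE(1)[OF assms(1)]] .
  show ?thesis using subfield_iff(2)[OF assms(2)] assms(3) by (intro T.subfield_iff(1)) auto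
qed

lemma (in ring) quadratic_tower_dimension:
  assumes "quadratic_tower K n M" "subfield K R"
  shows "dimension (2 ^ n) K M"
  using assms(1)
proof (induction rule: quadratic_tower.induct)
  case quadratic_tower_base
  show ?case using dimension_one[OF assms(2)] by simp
next
  case (quadratic_tower_step n L M)
  have "dimension (2 ^ n * 2) K M"
    using telescopic_base[OF assms(2) quadratic_tower_subfield(1)[OF quadratic_tower_step.hyps(1) assms(2)]]
      quadratic_tower_step by blast
  then show ?case by (simp add: mult.commute)
qed

text \<open>The inclusions in the top field \<open>M\<close> are recorded because they allow each
  step to be read inside \<open>M\<close> instead of the closure.\<close>

lemma (in ring) quadratic_tower_sequence:
  assumes "quadratic_tower K n M" "subfield K R"
  shows "\<exists>T. T 0 = K \<and> T n = M \<and> (\<forall>i \<le> n. subfield (T i) R \<and> T i \<subseteq> M) \<and>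
    (\<forall>i \<in> {1..n}. T (i - 1) \<subseteq> T i \<and> dimension 2 (T (i - 1)) (T i))"
  using assms(1)
proof (induction rule: quadratic_tower.induct)
  case quadratic_tower_base
  show ?case using assms(2) by (intro exI[of _ "\<lambda>_. K"]) auto
next
  case (quadratic_tower_step n L M)
  then obtain T where T: "T 0 = K" "T n = L" "\<And>i. i \<le> n \<Longrightarrow> subfield (T i) R \<and> T i \<subseteq> L"
    "\<And>i. i \<in> {1..n} \<Longrightarrow> T (i - 1) \<subseteq> T i \<and> dimension 2 (T (i - 1)) (T i)"
    by blast
  show ?case
    using T quadratic_tower_step.hyps
    by (intro exI[of _ "T(Suc n := M)"]) (force simp: le_Suc_eq)
qed

text \<open>The tower lives in \<open>L\<close>, whereas the extension has \<open>M\<close> as its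
  whole field; subfields and dimensions are transferred to the record with carrier \<open>M\<close>.
  The degree is multiplicative along the tower.\<close>

lemma generalized_2_extension_quadratic_tower:
  fixes L :: "('k, 'n) ring_scheme"
  assumes F: "field F" and L: "field L" and j: "j \<in> ring_hom F L"
    and tower: "ring.quadratic_tower L (j ` carrier F) n M"
  shows "generalized_2_extension F (L\<lparr>carrier := M\<rparr>) j"
    and "extension_degree F (L\<lparr>carrier := M\<rparr>) j = 2 ^ n"
proof -
  interpret F: field F by fact
  interpret L: field L by fact
  interpret j: ring_hom_ring F L j
    using j by (intro ring_hom_ringI2 F.ring_axioms L.ring_axioms)
  let ?K = "j ` carrier F" and ?M = "L\<lparr>carrier := M\<rparr>"
  have K: "subfield ?K L"
    using j.img_is_subfield(2)[OF F.carrier_is_subfield L.one_not_zero] .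
  have M: "subfield M L" "?K \<subseteq> M" using L.quadratic_tower_subfield[OF tower K] by auto
  interpret M: field ?M using L.subfield_iff(2)[OF M(1)] .
  have jM: "j \<in> ring_hom F ?M" using j M(2) by (auto simp: ring_hom_def)
  have KM: "subfield ?K ?M" by (rule L.subfield_restrict_carrier[OF M(1) K M(2)])
  have dim: "M.dimension (2 ^ n) ?K M"
    by (rule L.dimension_restrict_carrier[OF M(1) K L.quadratic_tower_dimension[OF tower K] order_refl])
  show "extension_degree F ?M j = 2 ^ n"
    using M.dimI[OF KM dim] by (simp add: extension_degree_def over_def)
  obtain T where T: "T 0 = ?K" "T n = M" "\<forall>i \<le> n. subfield (T i) L \<and> T i \<subseteq> M"
    "\<forall>i \<in> {1..n}. T (i - 1) \<subseteq> T i \<and> L.dimension 2 (T (i - 1)) (T i)"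
    using L.quadratic_tower_sequence[OF tower K] by (elim exE conjE) (rule that)
  have "subfield (T i) ?M" if "i \<le> n" for i
    using T(3) that L.subfield_restrict_carrier[OF M(1)] by simp
  moreover have "M.dimension 2 (T (i - 1)) (T i)" if i: "i \<in> {1..n}" for i
  proof -
    have "i - 1 \<le> n" "i \<le> n" using i by auto
    then have "subfield (T (i - 1)) L" "T i \<subseteq> M" using T(3) by auto
    then show ?thesis using T(4) i by (intro L.dimension_restrict_carrier[OF M(1)]) auto
  qed
  ultimately have "T 0 = j ` carrier F \<and> T n = carrier ?M \<and> (\<forall>i \<le> n. subfield (T i) ?M) \<and>
      (\<forall>i \<in> {1..n}. T (i - 1) \<subseteq> T i \<and> M.dimension 2 (T (i - 1)) (T i))"
    using T(1,2,4) by simp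
  then show "generalized_2_extension F ?M j"
    unfolding generalized_2_extension_def finite_field_extension_def field_extension_def
    using F M.field_axioms jM M.finite_dimensionI[OF dim] by auto
qed

section \<open>Coordinates on the scalar extension\<close>

text \<open>Every vector of \<open>N\<close> is an image, so each identity can be checked on
  preimages. This descends a form from the free module to the quotient.\<close>

lemma quadratic_form_surj:
  assumes f: "f \<in> module_hom R M N" and surj: "f ` carrier M = carrier N"
    and "module R M" and q: "quadratic_form R M (\<lambda>x. q (f x))"
  shows "quadratic_form R N q"
proof -
  interpret M: module R M by fact
  note fh = module_hom_add[OF f, symmetric] module_hom_smult[OF f, symmetric]
  have p: "polar_form R N q (f u) (f v) = polar_form R M (\<lambda>x. q (f x)) u v"
    if "u \<in> carrier M" "v \<in> carrier M" for u v
    using that by (simp add: polar_form_def module_hom_add[OF f])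
  show ?thesis
    using q unfolding quadratic_form_def bilinear_form_def surj[symmetric]
    by (auto simp: fh p Pi_iff)
qed

lemma quadratic_form_cong:
  assumes "module R M" and eq: "\<And>x. x \<in> carrier M \<Longrightarrow> p x = q x" and q: "quadratic_form R M q"
  shows "quadratic_form R M p"
proof -
  interpret M: module R M by fact
  have "polar_form R M p u v = polar_form R M q u v" if "u \<in> carrier M" "v \<in> carrier M" for u v
    using that by (simp add: polar_form_def eq)
  then show ?thesis
    using q unfolding quadratic_form_def bilinear_form_def by (simp add: Pi_iff eq)
qed

text \<open>Closure under negation is closure under multiplication by -1. The point is to make the
  theory of cosets available for \<open>N\<close>.\<close>

lemma submodule_abelian_subgroup:
  assumes "module R M" "submodule R N M"
  shows "abelian_subgroup N M"
proof -
  interpret M: module R M by fact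
  interpret N: submodule R N M by fact
  have neg: "\<ominus>\<^bsub>M\<^esub> v \<in> N" if "v \<in> N" for v
  proof -
    have "(\<ominus>\<^bsub>R\<^esub> \<one>\<^bsub>R\<^esub>) \<odot>\<^bsub>M\<^esub> v \<in> N" using that by simp
    then show ?thesis using N.subset that M.smult_minus_1[of v] by (metis subsetD)
  qed
  have "N \<noteq> {}" using N.zero_closed by (metis empty_iff)
  then have "subgroup N (add_monoid M)"
    using N.subset neg by (intro M.add.subgroupI) auto
  then show ?thesis
    by (intro abelian_subgroupI3 additive_subgroup.intro M.abelian_group_axioms)
qed

text \<open>A linear surjection is all that is used of the quotient: its forms are studied through
  their pullbacks to \<open>M\<close>.\<close>

lemma quotient_module_hom:
  assumes "module R M" "submodule R N M"
  shows "(\<lambda>x. N +>\<^bsub>M\<^esub> x) \<in> module_hom R M (quotient_module M N)"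
    and "(\<lambda>x. N +>\<^bsub>M\<^esub> x) ` carrier M = carrier (quotient_module M N)"
proof -
  interpret M: module R M by fact
  interpret N: submodule R N M by fact
  interpret N: abelian_subgroup N M by (rule submodule_abelian_subgroup[OF assms])
  have smult: "(\<Union>y \<in> N +>\<^bsub>M\<^esub> x. N +>\<^bsub>M\<^esub> (a \<odot>\<^bsub>M\<^esub> y)) = N +>\<^bsub>M\<^esub> (a \<odot>\<^bsub>M\<^esub> x)"
    if "a \<in> carrier R" "x \<in> carrier M" for a x
  proof -
    have "N +>\<^bsub>M\<^esub> (a \<odot>\<^bsub>M\<^esub> y) = N +>\<^bsub>M\<^esub> (a \<odot>\<^bsub>M\<^esub> x)" if y: "y \<in> N +>\<^bsub>M\<^esub> x" for y
    proof -
      obtain n where n: "n \<in> N" "y = n \<oplus>\<^bsub>M\<^esub> x"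
        using y by (auto simp: a_r_coset_def')
      have an: "a \<odot>\<^bsub>M\<^esub> n \<in> N" using n(1) \<open>a \<in> carrier R\<close> by simp
      have "a \<odot>\<^bsub>M\<^esub> y = (a \<odot>\<^bsub>M\<^esub> n) \<oplus>\<^bsub>M\<^esub> (a \<odot>\<^bsub>M\<^esub> x)"
        using n N.a_subset \<open>a \<in> carrier R\<close> \<open>x \<in> carrier M\<close> by (auto simp: M.smult_r_distr)
      then show ?thesis
        using an N.a_subset \<open>a \<in> carrier R\<close> \<open>x \<in> carrier M\<close>
        by (simp add: M.a_coset_add_assoc[symmetric] N.a_rcos_const subset_iff)
    qed
    moreover have "x \<in> N +>\<^bsub>M\<^esub> x" using N.a_rcos_self that by simp
    ultimately show ?thesis by blast
  qed
  show "(\<lambda>x. N +>\<^bsub>M\<^esub> x) ` carrier M = carrier (quotient_module M N)"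
    by (auto simp: quotient_module_def A_RCOSETS_def')
  then show "(\<lambda>x. N +>\<^bsub>M\<^esub> x) \<in> module_hom R M (quotient_module M N)"
    by (auto simp: module_hom_def quotient_module_def N.a_rcos_sum smult)
qed

text \<open>\<open>\<kappa> v\<close> is the coordinate vector of \<open>1 \<otimes> v\<close> with respect to the basis \<open>1 \<otimes> b\<close>, \<open>b \<in> B\<close>. The
  coordinate map descends to \<open>K \<otimes>\<^sub>F V\<close>; this yields the extended forms and shows that a vector
  with nonzero coordinates is nonzero.\<close>

locale coordinate_extension = field K + V: module F V
  for F :: "('a, 'm) ring_scheme" and V :: "('a, 'v, 'p) module_scheme"
    and K :: "('k, 'n) ring_scheme" (structure) +
  fixes j :: "'a \<Rightarrow> 'k" and B :: "'v set" and \<kappa> :: "'v \<Rightarrow> 'v \<Rightarrow> 'k"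
  assumes j: "j \<in> ring_hom F K" and B: "finite B" "B \<subseteq> carrier V"
    and \<kappa>: "v \<in> carrier V \<Longrightarrow> \<kappa> v \<in> carrier (free_module K B)"
    and \<kappa>_add: "u \<in> carrier V \<Longrightarrow> v \<in> carrier V \<Longrightarrow> \<kappa> (u \<oplus>\<^bsub>V\<^esub> v) = \<kappa> u \<oplus>\<^bsub>free_module K B\<^esub> \<kappa> v"
    and \<kappa>_smult: "a \<in> carrier F \<Longrightarrow> v \<in> carrier V \<Longrightarrow> \<kappa> (a \<odot>\<^bsub>V\<^esub> v) = j a \<odot>\<^bsub>free_module K B\<^esub> \<kappa> v"
    and \<kappa>_basis: "b \<in> B \<Longrightarrow> \<kappa> b = free_gen K b"
begin

abbreviation "M \<equiv> free_module K (carrier V)"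
abbreviation "W \<equiv> free_module K B"
abbreviation "N \<equiv> scalar_ext_kernel F K j V"

text \<open>The linear extension of \<open>\<kappa>\<close> from generators to all formal
  combinations; the sum over the support is finite on the carrier of \<open>M\<close>.\<close>

definition ext_coord :: "('v \<Rightarrow> 'k) \<Rightarrow> 'v \<Rightarrow> 'k"
  where "ext_coord x = (\<lambda>s. \<Oplus>v \<in> {v. x v \<noteq> \<zero>}. x v \<otimes> \<kappa> v s)"

lemma \<kappa>_closed: "v \<in> carrier V \<Longrightarrow> \<kappa> v s \<in> carrier K"
  using \<kappa> by (simp add: free_module_carrier_iff)

text \<open>Supports change under addition and scaling, so sums are compared over a common finite
  set of vectors; the extra terms are zero.\<close>

lemma ext_coord_superset:
  assumes x: "x \<in> carrier M" and A: "finite A" "{v. x v \<noteq> \<zero>} \<subseteq> A" "A \<subseteq> carrier V"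
  shows "ext_coord x s = (\<Oplus>v \<in> A. x v \<otimes> \<kappa> v s)"
  unfolding ext_coord_def
  using x A \<kappa>_closed
  by (intro add.finprod_mono_neutral_cong_left) (auto simp: free_module_carrier_iff Pi_iff)

lemma ext_coord_hom: "ext_coord \<in> module_hom K M W"
proof -
  have supp: "finite {v. x v \<noteq> \<zero>}" "{v. x v \<noteq> \<zero>} \<subseteq> carrier V" "\<And>v. x v \<in> carrier K"
    if "x \<in> carrier M" for x
    using that by (auto simp: free_module_carrier_iff)
  have c: "ext_coord x s \<in> carrier K" if "x \<in> carrier M" for x s
    unfolding ext_coord_def using supp[OF that] \<kappa>_closed by (intro finsum_closed) auto
  interpret M: module K M by (rule free_module_is_module)
  show ?thesis
    unfolding module_hom_def
  proof (intro CollectI conjI allI impI funcsetI)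
    fix x assume x: "x \<in> carrier M"
    have "ext_coord x s = \<zero>" if s: "s \<notin> B" for s
    proof -
      have "x v \<otimes> \<kappa> v s = \<zero>" if "x v \<noteq> \<zero>" for v
      proof -
        have "v \<in> carrier V" using supp[OF x] that by auto
        then show ?thesis using \<kappa>[of v] s supp(3)[OF x] by (simp add: free_module_carrier_iff)
      qed
      then show ?thesis unfolding ext_coord_def by (intro add.finprod_one_eqI) auto
    qed
    moreover from this have "{s. ext_coord x s \<noteq> \<zero>} \<subseteq> B" by auto
    ultimately show "ext_coord x \<in> carrier W"
      using c[OF x] B(1) by (auto simp: free_module_carrier_iff intro: finite_subset)
  next
    fix x y assume "x \<in> carrier M \<and> y \<in> carrier M"
    then have xy: "x \<in> carrier M" "y \<in> carrier M" "x \<oplus>\<^bsub>M\<^esub> y \<in> carrier M" by auto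
    let ?A = "{v. x v \<noteq> \<zero>} \<union> {v. y v \<noteq> \<zero>}"
    have A: "finite ?A" "?A \<subseteq> carrier V" using supp[OF xy(1)] supp[OF xy(2)] by auto
    have sub: "{v. (x \<oplus>\<^bsub>M\<^esub> y) v \<noteq> \<zero>} \<subseteq> ?A" by (auto simp: free_module_simps)
    have ex: "ext_coord x s = (\<Oplus>v \<in> ?A. x v \<otimes> \<kappa> v s)" for s
      by (rule ext_coord_superset[OF xy(1) A(1) _ A(2)]) auto
    have ey: "ext_coord y s = (\<Oplus>v \<in> ?A. y v \<otimes> \<kappa> v s)" for s
      by (rule ext_coord_superset[OF xy(2) A(1) _ A(2)]) auto
    show "ext_coord (x \<oplus>\<^bsub>M\<^esub> y) = ext_coord x \<oplus>\<^bsub>W\<^esub> ext_coord y"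
    proof
      fix s
      have f: "(\<lambda>v. x v \<otimes> \<kappa> v s) \<in> ?A \<rightarrow> carrier K" "(\<lambda>v. y v \<otimes> \<kappa> v s) \<in> ?A \<rightarrow> carrier K"
        using A(2) supp(3)[OF xy(1)] supp(3)[OF xy(2)] by (auto intro!: m_closed \<kappa>_closed)
      have "ext_coord (x \<oplus>\<^bsub>M\<^esub> y) s = (\<Oplus>v \<in> ?A. x v \<otimes> \<kappa> v s \<oplus> y v \<otimes> \<kappa> v s)"
        unfolding ext_coord_superset[OF xy(3) A(1) sub A(2)]
      proof (rule finsum_cong'[OF refl])
        show "(\<lambda>v. x v \<otimes> \<kappa> v s \<oplus> y v \<otimes> \<kappa> v s) \<in> ?A \<rightarrow> carrier K"
          using f by (auto simp: Pi_iff)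
        show "(x \<oplus>\<^bsub>M\<^esub> y) v \<otimes> \<kappa> v s = x v \<otimes> \<kappa> v s \<oplus> y v \<otimes> \<kappa> v s" if "v \<in> ?A" for v
          using that A(2) supp(3)[OF xy(1)] supp(3)[OF xy(2)] \<kappa>_closed[of v s]
          by (auto simp: free_module_simps l_distr)
      qed
      also have "\<dots> = ext_coord x s \<oplus> ext_coord y s"
        unfolding ex ey by (rule finsum_addf[OF f])
      finally show "ext_coord (x \<oplus>\<^bsub>M\<^esub> y) s = (ext_coord x \<oplus>\<^bsub>W\<^esub> ext_coord y) s"
        by (simp add: free_module_simps)
    qed
  next
    fix a x assume "a \<in> carrier K \<and> x \<in> carrier M"
    then have ax: "a \<in> carrier K" "x \<in> carrier M" "a \<odot>\<^bsub>M\<^esub> x \<in> carrier M" by auto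
    note A = supp(1,2)[OF ax(2)]
    have "{v. (a \<odot>\<^bsub>M\<^esub> x) v \<noteq> \<zero>} \<subseteq> {v. x v \<noteq> \<zero>}" using ax(1) by (auto simp: free_module_simps)
    note e = ext_coord_superset[OF ax(3) A(1) this A(2)]
    show "ext_coord (a \<odot>\<^bsub>M\<^esub> x) = a \<odot>\<^bsub>W\<^esub> ext_coord x"
    proof
      fix s
      have f: "(\<lambda>v. x v \<otimes> \<kappa> v s) \<in> {v. x v \<noteq> \<zero>} \<rightarrow> carrier K"
        using A(2) supp(3)[OF ax(2)] \<kappa>_closed by auto
      have "ext_coord (a \<odot>\<^bsub>M\<^esub> x) s = (\<Oplus>v \<in> {v. x v \<noteq> \<zero>}. a \<otimes> (x v \<otimes> \<kappa> v s))"
        unfolding e using f A(2) ax(1) supp(3)[OF ax(2)] \<kappa>_closed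
        by (intro finsum_cong') (auto simp: free_module_simps m_assoc)
      also have "\<dots> = a \<otimes> ext_coord x s"
        unfolding ext_coord_def by (rule finsum_rdistr[OF A(1) ax(1) f, symmetric])
      finally show "ext_coord (a \<odot>\<^bsub>M\<^esub> x) s = (a \<odot>\<^bsub>W\<^esub> ext_coord x) s"
        by (simp add: free_module_simps)
    qed
  qed
qed

lemma ext_coord_gen:
  assumes "v \<in> carrier V"
  shows "ext_coord (free_gen K v) = \<kappa> v"
proof
  fix s
  have "{w. free_gen K v w \<noteq> \<zero>} = {v}" by (auto simp: free_gen_def)
  then show "ext_coord (free_gen K v) s = \<kappa> v s"
    using \<kappa>_closed[OF assms] by (simp add: ext_coord_def free_gen_def)
qed

text \<open>Additivity and semilinearity of \<open>\<kappa>\<close> say precisely that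
  \<open>ext_coord\<close> kills the defining relations, hence also their span
  \<open>N\<close>.\<close>

lemma
  shows kernel_submodule: "submodule K N M"
    and kernel_ext_coord: "x \<in> N \<Longrightarrow> ext_coord x = \<zero>\<^bsub>W\<^esub>"
    and relations_kernel: "scalar_ext_relations F K j V \<subseteq> N"
proof -
  interpret M: module K M by (rule free_module_is_module)
  interpret W: module K W by (rule free_module_is_module)
  interpret E: mod_hom K M W ext_coord
    using ext_coord_hom by unfold_locales
  have jc: "j a \<in> carrier K" if "a \<in> carrier F" for a
    using j that by (auto simp: ring_hom_def)
  note g = free_gen_closed[of _ "carrier V"]
  have rel: "scalar_ext_relations F K j V \<subseteq> E.ker"
    unfolding scalar_ext_relations_def E.ker_def Let_def
    by (auto simp: g jc ext_coord_gen \<kappa> \<kappa>_add \<kappa>_smult)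
  then have rM: "scalar_ext_relations F K j V \<subseteq> carrier M" by (auto simp: E.ker_def)
  show "submodule K N M"
    unfolding scalar_ext_kernel_def by (rule M.span_is_submodule[OF rM])
  show "scalar_ext_relations F K j V \<subseteq> N"
    unfolding scalar_ext_kernel_def by (rule M.in_own_span[OF rM])
  have "N \<subseteq> E.ker"
    unfolding scalar_ext_kernel_def by (rule M.span_is_subset[OF rel E.ker_is_submodule])
  then show "x \<in> N \<Longrightarrow> ext_coord x = \<zero>\<^bsub>W\<^esub>" by (auto simp: E.ker_def)
qed

abbreviation "proj x \<equiv> N +>\<^bsub>M\<^esub> x"
abbreviation "E \<equiv> scalar_ext F K j V"

lemma proj_hom: "(\<lambda>x. proj x) \<in> module_hom K M E" "(\<lambda>x. proj x) ` carrier M = carrier E"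
  using quotient_module_hom[OF free_module_is_module kernel_submodule]
  by (simp_all add: scalar_ext_def)

lemma kernel_subgroup: "abelian_subgroup N M"
  by (rule submodule_abelian_subgroup[OF free_module_is_module kernel_submodule])

lemma proj_eqI:
  assumes "x \<in> carrier M" "y \<in> carrier M" "x \<ominus>\<^bsub>M\<^esub> y \<in> N"
  shows "proj x = proj y"
proof -
  interpret N: abelian_subgroup N M by (rule kernel_subgroup)
  have "x \<in> proj y" using assms by (intro N.a_rcos_module_rev) (auto simp: a_minus_def)
  then show ?thesis
    using N.a_repr_independence[OF _ assms(2) N.a_subgroup] by simp
qed

text \<open>Representatives of one coset differ by an element of \<open>N\<close>, which has zero
  coordinates. So the coordinate map is well defined on the tensor product.\<close>

lemma proj_eqD:
  assumes "x \<in> carrier M" "y \<in> carrier M" "proj x = proj y"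
  shows "ext_coord x = ext_coord y"
proof -
  interpret N: abelian_subgroup N M by (rule kernel_subgroup)
  interpret W: module K W by (rule free_module_is_module)
  have "x \<in> proj y" using N.a_rcos_self[OF assms(1)] assms(3) by simp
  then obtain n where n: "n \<in> N" "x = n \<oplus>\<^bsub>M\<^esub> y" by (auto simp: a_r_coset_def')
  then have "n \<in> carrier M" using N.a_subset by auto
  moreover have "ext_coord y \<in> carrier W"
    using module_hom_closed[OF ext_coord_hom] assms(2) by auto
  ultimately show ?thesis
    using n module_hom_add[OF ext_coord_hom _ assms(2)] kernel_ext_coord[OF n(1)] by simp
qed

text \<open>Existence: \<open>Q\<close> composed with the coordinate map descends to the quotient.
  Uniqueness: a competitor is pulled back to the free module and compared with \<open>Q\<close>
  there by \<open>quadratic_form_eqI\<close>.\<close>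

lemma scalar_ext_form_proj:
  assumes q: "quadratic_form F V q" and Q: "quadratic_form K W Q"
    and Qq: "\<And>v. v \<in> carrier V \<Longrightarrow> Q (\<kappa> v) = j (q v)" and x: "x \<in> carrier M"
  shows "scalar_ext_form F K j V q (proj x) = Q (ext_coord x)"
proof -
  interpret M: module K M by (rule free_module_is_module)
  \<comment> \<open>The choice of representative is immaterial by \<open>proj_eqD\<close>;
    \<open>restrict\<close> supplies the extensionality demanded of the extended form.\<close>
  define P where "P = restrict (\<lambda>C. Q (ext_coord (SOME x. x \<in> carrier M \<and> proj x = C))) (carrier E)"
  have P: "P (proj x) = Q (ext_coord x)" if "x \<in> carrier M" for x
  proof -
    let ?y = "SOME y. y \<in> carrier M \<and> proj y = proj x"
    have "?y \<in> carrier M \<and> proj ?y = proj x" by (rule someI[of _ x]) (use that in simp)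
    then have "ext_coord ?y = ext_coord x" using proj_eqD that by blast
    moreover have "proj x \<in> carrier E" using proj_hom(2) that by blast
    ultimately show ?thesis by (simp add: P_def)
  qed
  have vec: "scalar_ext_vec F K j V v = proj (free_gen K v)" for v
    by (simp add: scalar_ext_vec_def)
  note g = free_gen_closed[of _ "carrier V"]
  have QM: "quadratic_form K M (\<lambda>x. Q (ext_coord x))"
    by (rule quadratic_form_comp[OF is_cring free_module_is_module Q ext_coord_hom])
  have "quadratic_form K M (\<lambda>x. P (proj x))"
    by (rule quadratic_form_cong[OF M.module_axioms P QM])
  then have PE: "quadratic_form K E P"
    by (rule quadratic_form_surj[OF proj_hom M.module_axioms])
  have "scalar_ext_form F K j V q = P"
    unfolding scalar_ext_form_def
  proof (rule the_equality)
    show "P \<in> extensional (carrier E) \<and> quadratic_form K E P \<and>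
        (\<forall>v \<in> carrier V. P (scalar_ext_vec F K j V v) = j (q v))"
      using PE by (simp add: vec P g ext_coord_gen Qq) (simp add: P_def)
  next
    fix P' assume P': "P' \<in> extensional (carrier E) \<and> quadratic_form K E P' \<and>
        (\<forall>v \<in> carrier V. P' (scalar_ext_vec F K j V v) = j (q v))"
    have P'M: "quadratic_form K M (\<lambda>x. P' (proj x))"
      by (rule quadratic_form_comp[OF is_cring free_module_is_module _ proj_hom(1)]) (use P' in simp)
    have gen: "P' (proj (free_gen K v)) = Q (ext_coord (free_gen K v))" if "v \<in> carrier V" for v
      using P' that by (simp add: vec ext_coord_gen Qq)
    have "P' (proj x) = Q (ext_coord x)" if x: "x \<in> carrier M" for x
    proof (rule quadratic_form_eqI[OF P'M QM gen _ x])
      fix s t assume st: "s \<in> carrier V" "t \<in> carrier V"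
      \<comment> \<open>Modulo the additivity relation the sum of two generators is again a
        generator, where the value is prescribed.\<close>
      let ?u = "free_gen K (s \<oplus>\<^bsub>V\<^esub> t)" and ?w = "free_gen K s \<oplus>\<^bsub>M\<^esub> free_gen K t"
      have c: "?u \<in> carrier M" "?w \<in> carrier M" using st g by auto
      have "?u \<ominus>\<^bsub>M\<^esub> ?w \<in> scalar_ext_relations F K j V"
        using st by (auto simp: scalar_ext_relations_def Let_def)
      then have eq: "proj ?u = proj ?w"
        using relations_kernel by (intro proj_eqI c) auto
      then show "P' (proj ?w) = Q (ext_coord ?w)"
        using gen[of "s \<oplus>\<^bsub>V\<^esub> t"] st proj_eqD[OF c eq] by simp
    qed
    then have "P' C = P C" if "C \<in> carrier E" for C
      using that P unfolding proj_hom(2)[symmetric] by auto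
    then show "P' = P"
      using P' by (intro extensionalityI[of _ "carrier E"]) (auto simp: P_def)
  qed
  then show ?thesis using P[OF x] by simp
qed

text \<open>Since \<open>B\<close> consists of vectors of V, a function supported on
  \<open>B\<close> is itself a formal combination, and \<open>\<kappa>\<close> sends each b in
  \<open>B\<close> to its unit vector. Thus coordinate vectors serve as their own
  representatives.\<close>

lemma ext_coord_id:
  assumes "y \<in> carrier W"
  shows "ext_coord y = y"
proof -
  interpret M: module K M by (rule free_module_is_module)
  have sub: "x \<in> carrier M" if "x \<in> carrier W" for x
    using that B(2) by (auto simp: free_module_carrier_iff)
  have ops: "x \<oplus>\<^bsub>W\<^esub> z = x \<oplus>\<^bsub>M\<^esub> z" "a \<odot>\<^bsub>W\<^esub> x = a \<odot>\<^bsub>M\<^esub> x" for x z a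
    by (simp_all add: free_module_simps)
  show ?thesis using assms
  proof (induction rule: free_module_induct)
    case zero
    show ?case by (simp add: ext_coord_def)
  next
    case (add x a s)
    have s: "s \<in> carrier V" using add B(2) by auto
    then have g: "free_gen K s \<in> carrier M" by (rule free_gen_closed)
    have "ext_coord (x \<oplus>\<^bsub>M\<^esub> (a \<odot>\<^bsub>M\<^esub> free_gen K s)) = x \<oplus>\<^bsub>W\<^esub> (a \<odot>\<^bsub>W\<^esub> free_gen K s)"
      using add sub g module_hom_add[OF ext_coord_hom] module_hom_smult[OF ext_coord_hom]
      by (simp add: ext_coord_gen[OF s] \<kappa>_basis)
    then show ?case by (simp add: ops)
  qed
qed

text \<open>The isotropic vector is the class of \<open>y\<close>, the sum of the y(b) (1 \<otimes>
  b). It is nonzero because an element of \<open>N\<close> has zero coordinates, while those of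
  \<open>y\<close> are \<open>y\<close> itself.\<close>

lemma isotropic_scalar_ext:
  assumes "quadratic_system F V \<phi>"
    and Q: "\<And>q. q \<in> set \<phi> \<Longrightarrow> quadratic_form K W (Q q) \<and> Q q y = \<zero> \<and>
      (\<forall>v \<in> carrier V. Q q (\<kappa> v) = j (q v))"
    and y: "y \<in> carrier W" "y \<noteq> (\<lambda>s. \<zero>)"
  shows "isotropic K E (scalar_ext_system F K j V \<phi>)"
proof -
  interpret N: abelian_subgroup N M by (rule kernel_subgroup)
  have yM: "y \<in> carrier M" using y(1) B(2) by (auto simp: free_module_carrier_iff)
  have "proj y \<in> carrier E" using yM proj_hom(2) by blast
  moreover have "proj y \<noteq> \<zero>\<^bsub>E\<^esub>"
  proof
    assume "proj y = \<zero>\<^bsub>E\<^esub>"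
    then have "proj y = N" by (simp add: scalar_ext_def quotient_module_def)
    then have "y \<in> N" using N.a_rcos_self[OF yM] by simp
    then show False using kernel_ext_coord ext_coord_id[OF y(1)] y(2) by (simp add: free_module_simps)
  qed
  moreover have "scalar_ext_form F K j V q (proj y) = \<zero>" if "q \<in> set \<phi>" for q
    using scalar_ext_form_proj[of q "Q q" y] assms(1) Q[OF that] that yM ext_coord_id[OF y(1)]
    by (simp add: quadratic_system_def)
  ultimately show ?thesis
    unfolding isotropic_def scalar_ext_system_def by (intro bexI[of _ "proj y"]) auto
qed

end

section \<open>Extending quadratic forms to the algebraic closure\<close>

text \<open>Forms are built once, over the closure. Rationality makes their values and polar forms
  at \<open>T\<close>-rational points land in \<open>T\<close>, so they can be read over the field
  reached by the tower.\<close>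

lemma (in field) quadratic_form_restrict_carrier:
  assumes q: "quadratic_form R (free_module R S) q" and qK: "rational R K S q"
    and T: "subfield T R" "K \<subseteq> T"
  shows "quadratic_form (R\<lparr>carrier := T\<rparr>) (free_module (R\<lparr>carrier := T\<rparr>) S) q"
proof -
  let ?T = "R\<lparr>carrier := T\<rparr>"
  let ?V = "free_module R S" and ?W = "free_module ?T S"
  interpret T: field ?T using subfield_iff(2)[OF T(1)] .
  have ops: "u \<oplus>\<^bsub>?W\<^esub> v = u \<oplus>\<^bsub>?V\<^esub> v" "a \<odot>\<^bsub>?W\<^esub> v = a \<odot>\<^bsub>?V\<^esub> v" for u v a
    by (simp_all add: free_module_simps)
  have sub: "u \<in> carrier ?V" if "u \<in> carrier ?W" for u
    using free_module_subfield_subset[OF subfieldE(3)[OF T(1)] that] .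
  note qT = rationalD[OF qK T]
  have qp: "polar_form R ?V q u v \<in> T" if "u \<in> carrier ?W" "v \<in> carrier ?W" for u v
    unfolding polar_form_def using that T(1)
    by (intro subfield_closed[OF T(1)] qT free_module_subfield_add)
  show ?thesis
  proof (rule quadratic_formI[OF T.is_cring _ _ _ _ T.free_module_is_module, where b = "polar_form R ?V q"])
    show "q \<in> carrier ?W \<rightarrow> carrier ?T" using qT by auto
    show "q (a \<odot>\<^bsub>?W\<^esub> v) = (a \<otimes>\<^bsub>?T\<^esub> a) \<otimes>\<^bsub>?T\<^esub> q v" if "a \<in> carrier ?T" "v \<in> carrier ?W" for a v
      using q that sub subfieldE(3)[OF T(1)] by (auto simp: ops quadratic_form_def)
    show "bilinear_form ?T ?W (polar_form R ?V q)"
      using q sub subfieldE(3)[OF T(1)] qp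
      by (auto simp: ops quadratic_form_def bilinear_form_def subset_iff)
    show "q (u \<oplus>\<^bsub>?W\<^esub> v) = (q u \<oplus>\<^bsub>?T\<^esub> q v) \<oplus>\<^bsub>?T\<^esub> polar_form R ?V q u v"
      if "u \<in> carrier ?W" "v \<in> carrier ?W" for u v
    proof -
      have "u \<oplus>\<^bsub>?V\<^esub> v \<in> carrier ?V"
        unfolding free_module_simps by (intro free_module_add_closed sub that)
      then show ?thesis
        using quadratic_form_polar[OF is_cring q] sub that by (simp add: ops)
    qed
  qed
qed

lemma (in cring) linear_functional_add:
  assumes "linear_functional R M k" "linear_functional R M l"
  shows "linear_functional R M (\<lambda>x. k x \<oplus> l x)"
  using linear_functionalD[OF assms(1)] linear_functionalD[OF assms(2)]
  by (auto simp: linear_functional_def r_distr a_ac)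

lemma (in cring) linear_functional_smult:
  assumes "linear_functional R M l" "c \<in> carrier R"
  shows "linear_functional R M (\<lambda>x. c \<otimes> l x)"
  using linear_functionalD[OF assms(1)] assms(2)
  by (auto simp: linear_functional_def r_distr m_ac)

lemma (in cring) linear_functional_coord: "linear_functional R (free_module R S) (\<lambda>x. x s)"
  by (auto simp: linear_functional_def free_module_carrier_iff free_module_simps)

lemma (in field) rational_add:
  "rational R K S f \<Longrightarrow> rational R K S g \<Longrightarrow> rational R K S (\<lambda>x. f x \<oplus> g x)"
  by (auto simp: rational_def intro!: subfield_closed)

lemma (in field) rational_mult:
  "rational R K S f \<Longrightarrow> rational R K S g \<Longrightarrow> rational R K S (\<lambda>x. f x \<otimes> g x)"
  by (auto simp: rational_def intro!: subfield_closed)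

lemma rational_const: "c \<in> K \<Longrightarrow> rational R K S (\<lambda>x. c)"
  by (auto simp: rational_def)

lemma rational_coord: "rational R K S (\<lambda>x. x s)"
  by (auto simp: rational_def free_module_carrier_iff)

definition restrict_coords :: "('k, 'n) ring_scheme \<Rightarrow> 's set \<Rightarrow> ('s \<Rightarrow> 'k) \<Rightarrow> 's \<Rightarrow> 'k"
  where "restrict_coords R S x = (\<lambda>s. if s \<in> S then x s else \<zero>\<^bsub>R\<^esub>)"

lemma (in field) restrict_coords_rational_hom:
  "restrict_coords R S \<in> rational_hom R K S' S"
proof -
  have c: "restrict_coords R S x \<in> carrier (free_module (R\<lparr>carrier := T\<rparr>) S)"
    if "\<zero> \<in> T" "x \<in> carrier (free_module (R\<lparr>carrier := T\<rparr>) S')" for x T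
  proof -
    have "finite {s. x s \<noteq> \<zero>}" using that(2) by (auto simp: free_module_carrier_iff)
    then have "finite {s. restrict_coords R S x s \<noteq> \<zero>}"
      by (rule rev_finite_subset) (auto simp: restrict_coords_def)
    then show ?thesis using that by (auto simp: restrict_coords_def free_module_carrier_iff)
  qed
  have "restrict_coords R S \<in> carrier (free_module R S') \<rightarrow> carrier (free_module R S)"
    using c[of "carrier R"] by (auto simp: free_module_carrier_iff)
  then have "restrict_coords R S \<in> module_hom R (free_module R S') (free_module R S)"
    by (auto simp: module_hom_def free_module_simps restrict_coords_def fun_eq_iff)
  then show ?thesis
    unfolding rational_hom_def using c subfield_closed(5) by blast
qed

locale module_in_extension = field L + V: module F V
  for F :: "('a, 'm) ring_scheme" and V :: "('a, 'v, 'p) module_scheme"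
    and L :: "('k, 'n) ring_scheme" (structure) +
  fixes j :: "'a \<Rightarrow> 'k"
  assumes F: "field F" and j: "j \<in> ring_hom F L"
begin

abbreviation "jF \<equiv> j ` carrier F"

text \<open>Coefficients from F moved into \<open>L\<close> and set to zero outside
  \<open>B\<close>, as membership in the free module on \<open>B\<close> demands.\<close>

definition lift :: "'v set \<Rightarrow> ('v \<Rightarrow> 'a) \<Rightarrow> 'v \<Rightarrow> 'k"
  where "lift B a = (\<lambda>s. if s \<in> B then j (a s) else \<zero>)"

lemma j_simps:
  "a \<in> carrier F \<Longrightarrow> j a \<in> carrier L"
  "a \<in> carrier F \<Longrightarrow> b \<in> carrier F \<Longrightarrow> j (a \<oplus>\<^bsub>F\<^esub> b) = j a \<oplus> j b"
  "a \<in> carrier F \<Longrightarrow> b \<in> carrier F \<Longrightarrow> j (a \<otimes>\<^bsub>F\<^esub> b) = j a \<otimes> j b"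
  "j \<one>\<^bsub>F\<^esub> = \<one>"
  "j \<zero>\<^bsub>F\<^esub> = \<zero>"
proof -
  interpret j: ring_hom_ring F L j
    by (rule ring_hom_ringI2[OF field.is_ring[OF F] ring_axioms j])
  show "a \<in> carrier F \<Longrightarrow> j a \<in> carrier L"
    "a \<in> carrier F \<Longrightarrow> b \<in> carrier F \<Longrightarrow> j (a \<oplus>\<^bsub>F\<^esub> b) = j a \<oplus> j b"
    "a \<in> carrier F \<Longrightarrow> b \<in> carrier F \<Longrightarrow> j (a \<otimes>\<^bsub>F\<^esub> b) = j a \<otimes> j b"
    "j \<one>\<^bsub>F\<^esub> = \<one>"  "j \<zero>\<^bsub>F\<^esub> = \<zero>"
    by simp_all
qed

lemma restrict_coords_lift: "b \<notin> B \<Longrightarrow> restrict_coords L B (lift (insert b B) a) = lift B a"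
  by (auto simp: restrict_coords_def lift_def)

text \<open>Induction on \<open>B\<close>: splitting off \<open>b\<close> adds the linear term with
  coefficient j (l b), which lies in the image of F.\<close>

lemma exists_rational_functional:
  assumes l: "linear_functional F V l" and "finite B" "B \<subseteq> carrier V"
  shows "\<exists>l'. linear_functional L (free_module L B) l' \<and> rational L jF B l' \<and>
    (\<forall>a \<in> B \<rightarrow> carrier F. l' (lift B a) = j (l (V.lincomb a B)))"
  using assms(2,3)
proof (induction B rule: finite_induct)
  case empty
  note ll = linear_functionalD[OF l]
  have "l \<zero>\<^bsub>V\<^esub> = \<zero>\<^bsub>F\<^esub>"
    using ll(3)[of "\<zero>\<^bsub>F\<^esub>" "\<zero>\<^bsub>V\<^esub>"] ll(1)[of "\<zero>\<^bsub>V\<^esub>"] by simp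
  then have "\<forall>a \<in> {} \<rightarrow> carrier F. \<zero> = j (l (V.lincomb a {}))"
    by (simp add: V.lincomb_def j_simps)
  moreover have "linear_functional L (free_module L {}) (\<lambda>x. \<zero>)" by (simp add: linear_functional_def)
  moreover have "rational L jF {} (\<lambda>x. \<zero>)"
    by (auto simp: rational_def dest: subfield_closed(5))
  ultimately show ?case by blast
next
  case (insert b B)
  then obtain l' where l': "linear_functional L (free_module L B) l'" "rational L jF B l'"
    and ext: "\<And>a. a \<in> B \<rightarrow> carrier F \<Longrightarrow> l' (lift B a) = j (l (V.lincomb a B))" by auto
  note ll = linear_functionalD[OF l]
  have b: "b \<in> carrier V" and B: "B \<subseteq> carrier V" using insert.prems by auto
  note res = restrict_coords_rational_hom[of B jF "insert b B"]
  let ?l = "\<lambda>x. l' (restrict_coords L B x) \<oplus> j (l b) \<otimes> x b"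
  have "linear_functional L (free_module L (insert b B)) ?l"
    using b by (intro linear_functional_add linear_functional_smult linear_functional_coord
        linear_functional_comp[OF l'(1) rational_homD(1)[OF res]] j_simps ll(1))
  moreover have "rational L jF (insert b B) ?l"
    using b by (intro rational_add rational_mult rational_const rational_coord rational_comp[OF l'(2) res]
        imageI ll(1))
  moreover have "?l (lift (insert b B) a) = j (l (V.lincomb a (insert b B)))"
    if a: "a \<in> insert b B \<rightarrow> carrier F" for a
  proof -
    have "V.lincomb a B \<in> carrier V" using a B by (intro V.lincomb_closed) auto
    moreover have "V.lincomb a (insert b B) = (a b \<odot>\<^bsub>V\<^esub> b) \<oplus>\<^bsub>V\<^esub> V.lincomb a B"
      using V.lincomb_insert[OF insert.hyps(1) B _ insert.hyps(2) b] a by simp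
    moreover have "lift (insert b B) a b = j (a b)" by (simp add: lift_def)
    ultimately show ?thesis
      using a b ll ext[of a] restrict_coords_lift[OF insert.hyps(2), of a]
      by (simp add: j_simps Pi_iff a_comm m_comm)
  qed
  ultimately show ?case by blast
qed

text \<open>From q(c b + v) = c^2 q(b) + q(v) + c b_q(b, v), splitting off \<open>b\<close> adds a
  square term and a product of the new coordinate with the extension of the functional b_q(b, -).
  The result is a triangular coefficient formula, valid in characteristic 2 as well.\<close>

lemma exists_rational_quadratic_form:
  assumes q: "quadratic_form F V q" and "finite B" "B \<subseteq> carrier V"
  shows "\<exists>q'. quadratic_form L (free_module L B) q' \<and> rational L jF B q' \<and>
    (\<forall>a \<in> B \<rightarrow> carrier F. q' (lift B a) = j (q (V.lincomb a B)))"
  using assms(2,3)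
proof (induction B rule: finite_induct)
  case empty
  have "q (\<zero>\<^bsub>F\<^esub> \<odot>\<^bsub>V\<^esub> \<zero>\<^bsub>V\<^esub>) = (\<zero>\<^bsub>F\<^esub> \<otimes>\<^bsub>F\<^esub> \<zero>\<^bsub>F\<^esub>) \<otimes>\<^bsub>F\<^esub> q \<zero>\<^bsub>V\<^esub>" "q \<zero>\<^bsub>V\<^esub> \<in> carrier F"
    using q V.zero_closed V.M.zero_closed unfolding quadratic_form_def by blast+
  then have "q \<zero>\<^bsub>V\<^esub> = \<zero>\<^bsub>F\<^esub>" by simp
  then have "\<forall>a \<in> {} \<rightarrow> carrier F. \<zero> = j (q (V.lincomb a {}))"
    by (simp add: V.lincomb_def j_simps)
  moreover have "quadratic_form L (free_module L {}) (\<lambda>x. \<zero>)"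
    by (simp add: quadratic_form_def bilinear_form_def polar_form_def a_minus_def)
  moreover have "rational L jF {} (\<lambda>x. \<zero>)"
    by (auto simp: rational_def dest: subfield_closed(5))
  ultimately show ?case by blast
next
  case (insert b B)
  then obtain q' where q': "quadratic_form L (free_module L B) q'" "rational L jF B q'"
    and q'_ext: "\<And>a. a \<in> B \<rightarrow> carrier F \<Longrightarrow> q' (lift B a) = j (q (V.lincomb a B))" by auto
  have b: "b \<in> carrier V" and B: "B \<subseteq> carrier V" using insert.prems by auto
  have pl: "linear_functional F V (polar_form F V q b)" by (rule linear_functional_polar[OF q b])
  obtain l' where l': "linear_functional L (free_module L B) l'" "rational L jF B l'"
    and l'_ext: "\<And>a. a \<in> B \<rightarrow> carrier F \<Longrightarrow> l' (lift B a) = j (polar_form F V q b (V.lincomb a B))"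
    using exists_rational_functional[OF pl insert.hyps(1) B] by auto
  have qc: "q v \<in> carrier F" if "v \<in> carrier V" for v using q that by (auto simp: quadratic_form_def)
  note res = restrict_coords_rational_hom[of B jF "insert b B"]
  let ?V = "free_module L (insert b B)"
  let ?q = "\<lambda>x. (j (q b) \<otimes> (x b \<otimes> x b) \<oplus> q' (restrict_coords L B x)) \<oplus> x b \<otimes> l' (restrict_coords L B x)"
  have "quadratic_form L ?V ?q"
    using b by (intro quadratic_form_add quadratic_form_mult quadratic_form_smult linear_functional_coord
        linear_functional_comp[OF l'(1) rational_homD(1)[OF res]]
        quadratic_form_comp[OF _ _ q'(1) rational_homD(1)[OF res]] j_simps qc is_cring free_module_is_module)
  moreover have "rational L jF (insert b B) ?q"
    using b by (intro rational_add rational_mult rational_const rational_coord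
        rational_comp[OF l'(2) res] rational_comp[OF q'(2) res] imageI qc)
  moreover have "?q (lift (insert b B) a) = j (q (V.lincomb a (insert b B)))"
    if a: "a \<in> insert b B \<rightarrow> carrier F" for a
  proof -
    have ab: "a b \<in> carrier F" using a by auto
    have c: "V.lincomb a B \<in> carrier V" using a B by (intro V.lincomb_closed) auto
    have "V.lincomb a (insert b B) = (a b \<odot>\<^bsub>V\<^esub> b) \<oplus>\<^bsub>V\<^esub> V.lincomb a B"
      using V.lincomb_insert[OF insert.hyps(1) B _ insert.hyps(2) b] a by simp
    then have "q (V.lincomb a (insert b B)) =
        (q (a b \<odot>\<^bsub>V\<^esub> b) \<oplus>\<^bsub>F\<^esub> q (V.lincomb a B)) \<oplus>\<^bsub>F\<^esub> polar_form F V q (a b \<odot>\<^bsub>V\<^esub> b) (V.lincomb a B)"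
      using quadratic_form_polar[OF V.R.is_cring q, of "a b \<odot>\<^bsub>V\<^esub> b" "V.lincomb a B"] ab b c by simp
    also have "q (a b \<odot>\<^bsub>V\<^esub> b) = (a b \<otimes>\<^bsub>F\<^esub> a b) \<otimes>\<^bsub>F\<^esub> q b"
      using q ab b by (simp add: quadratic_form_def)
    also have "polar_form F V q (a b \<odot>\<^bsub>V\<^esub> b) (V.lincomb a B) = a b \<otimes>\<^bsub>F\<^esub> polar_form F V q b (V.lincomb a B)"
      using q ab b c by (simp add: quadratic_form_def bilinear_form_def)
    finally have "j (q (V.lincomb a (insert b B))) =
        ((j (a b) \<otimes> j (a b)) \<otimes> j (q b) \<oplus> j (q (V.lincomb a B))) \<oplus> j (a b) \<otimes> j (polar_form F V q b (V.lincomb a B))"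
      using ab b c qc linear_functionalD(1)[OF pl c] by (simp add: j_simps)
    moreover have "lift (insert b B) a b = j (a b)" by (simp add: lift_def)
    ultimately show ?thesis
      using a ab b qc q'_ext[of a] l'_ext[of a] restrict_coords_lift[OF insert.hyps(2), of a]
      by (simp add: j_simps Pi_iff m_comm)
  qed
  ultimately show ?case by blast
qed

end

section \<open>Coordinates with respect to a basis, and the conclusion\<close>

lemma (in vectorspace) exists_coordinates:
  assumes B: "finite B" "basis B"
  shows "\<exists>c. (\<forall>v \<in> carrier V. c v \<in> B \<rightarrow> carrier K \<and> lincomb (c v) B = v) \<and>
    (\<forall>a \<in> B \<rightarrow> carrier K. \<forall>b \<in> B. c (lincomb a B) b = a b)"
proof -
  have BV: "B \<subseteq> carrier V" using B(2) by (simp add: basis_def)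
  have ex1: "\<exists>!a. a \<in> B \<rightarrow>\<^sub>E carrier K \<and> lincomb a B = v" if "v \<in> carrier V" for v
    using basis_criterion[OF B(1) BV] B(2) that by blast
  define c where "c v = (THE a. a \<in> B \<rightarrow>\<^sub>E carrier K \<and> lincomb a B = v)" for v
  have c: "c v \<in> B \<rightarrow>\<^sub>E carrier K" "lincomb (c v) B = v" if "v \<in> carrier V" for v
    using theI'[OF ex1[OF that]] by (auto simp: c_def)
  have "c (lincomb a B) b = a b" if a: "a \<in> B \<rightarrow> carrier K" and b: "b \<in> B" for a b
  proof -
    \<comment> \<open>Coefficients are unique only among functions that are undefined outside
      \<open>B\<close>, hence the restriction.\<close>
    have "lincomb (restrict a B) B = lincomb a B" by (rule lincomb_cong[OF refl BV _ a]) simp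
    moreover have "restrict a B \<in> B \<rightarrow>\<^sub>E carrier K" using a by auto
    ultimately have "c (lincomb a B) = restrict a B"
      using ex1[OF lincomb_closed[OF BV a]] c[OF lincomb_closed[OF BV a]] by blast
    then show ?thesis using b by simp
  qed
  then show ?thesis using c by (intro exI[of _ c]) (auto simp: PiE_def)
qed

lemma (in module) lincomb_delta:
  assumes "finite B" "B \<subseteq> carrier M" "b \<in> B"
  shows "lincomb (\<lambda>w. if w = b then \<one>\<^bsub>R\<^esub> else \<zero>\<^bsub>R\<^esub>) B = b"
proof -
  let ?a = "\<lambda>w. if w = b then \<one>\<^bsub>R\<^esub> else \<zero>\<^bsub>R\<^esub>"
  have "lincomb ?a (B - {b}) = \<zero>\<^bsub>M\<^esub>"
    unfolding lincomb_def using assms(2) by (intro M.add.finprod_one_eqI) auto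
  moreover have "lincomb ?a B = (?a b \<odot>\<^bsub>M\<^esub> b) \<oplus>\<^bsub>M\<^esub> lincomb ?a (B - {b})"
    by (rule lincomb_del2[OF assms(1,2) _ assms(3)]) auto
  ultimately show ?thesis using assms by auto
qed

theorem theorem2p1:
  fixes F :: "('a, 'm) ring_scheme"
    and V :: "('a, 'v, 'p) module_scheme"
    and \<phi> :: "('v \<Rightarrow> 'a) list"
    and r :: nat
  assumes "field F"
    and "r \<ge> 1"
    and "vectorspace F V"
    and "vectorspace.fin_dim F V"
    and "length \<phi> = r"
    and "quadratic_system F V \<phi>"
    and "vectorspace.dim F V \<ge> r * (r + 1) div 2 + 1"
  shows "\<exists>(F' :: 'a extension_field) j.
    generalized_2_extension F F' j \<and>
    extension_degree F F' j \<le> 2 ^ r \<and>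
    isotropic F' (scalar_ext F F' j V) (scalar_ext_system F F' j V \<phi>)"
proof -
  interpret F: field F by fact
  interpret V: vectorspace F V by fact
  \<comment> \<open>The elements of this closure have the type prescribed for the extension field,
    so every field of the tower fits into it.\<close>
  define L where "L = F.alg_closure"
  define j where "j = (F.indexed_const :: 'a \<Rightarrow> ('a list \<times> nat) multiset \<Rightarrow> 'a)"
  let ?K = "j ` carrier F"
  interpret L: algebraic_closure L ?K
    unfolding L_def j_def by (rule F.alg_closureE(1))
  have j: "j \<in> ring_hom F L" unfolding L_def j_def by (rule F.alg_closureE(2))
  have K: "subfield ?K L" by (rule L.subfield_axioms)
  interpret X: module_in_extension F V L j
    by unfold_locales (use j in auto)
  obtain B where B: "finite B" "V.basis B" using V.finite_basis_exists assms(4) by blast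
  have BV: "B \<subseteq> carrier V" using B(2) by (simp add: V.basis_def)
  obtain c where c: "\<And>v. v \<in> carrier V \<Longrightarrow> c v \<in> B \<rightarrow> carrier F"
      "\<And>v. v \<in> carrier V \<Longrightarrow> V.lincomb (c v) B = v"
      "\<And>a b. a \<in> B \<rightarrow> carrier F \<Longrightarrow> b \<in> B \<Longrightarrow> c (V.lincomb a B) b = a b"
    using V.exists_coordinates[OF B] by blast
  have qF: "quadratic_form F V q" if "q \<in> set \<phi>" for q
    using assms(6) that by (simp add: quadratic_system_def)
  have "\<forall>q \<in> set \<phi>. \<exists>q'. quadratic_form L (free_module L B) q' \<and> rational L ?K B q' \<and>
      (\<forall>a \<in> B \<rightarrow> carrier F. q' (X.lift B a) = j (q (V.lincomb a B)))"
    using X.exists_rational_quadratic_form[OF qF B(1) BV] by blast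
  then obtain Q where Q: "\<And>q. q \<in> set \<phi> \<Longrightarrow> quadratic_form L (free_module L B) (Q q)"
      "\<And>q. q \<in> set \<phi> \<Longrightarrow> rational L ?K B (Q q)"
      "\<And>q a. q \<in> set \<phi> \<Longrightarrow> a \<in> B \<rightarrow> carrier F \<Longrightarrow> Q q (X.lift B a) = j (q (V.lincomb a B))"
    by (elim bchoice[elim_format] exE) blast
  have "length (map Q \<phi>) * (length (map Q \<phi>) + 1) div 2 + 1 \<le> card B"
    using assms(5,7) V.dim_basis[OF B] by simp
  moreover have "quadratic_form L (free_module L B) q \<and> rational L ?K B q" if "q \<in> set (map Q \<phi>)" for q
    using that Q(1,2) by auto
  ultimately have "\<exists>n M x. n \<le> length (map Q \<phi>) \<and> L.quadratic_tower ?K n M \<and>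
      x \<in> carrier (free_module (L\<lparr>carrier := M\<rparr>) B) \<and> x \<noteq> (\<lambda>s. \<zero>\<^bsub>L\<^esub>) \<and>
      (\<forall>q \<in> set (map Q \<phi>). q x = \<zero>\<^bsub>L\<^esub>)"
    by (rule L.common_zero_in_quadratic_tower[OF K B(1)])
  then obtain n M y where n: "n \<le> r" and tower: "L.quadratic_tower ?K n M"
    and y: "y \<in> carrier (free_module (L\<lparr>carrier := M\<rparr>) B)" "y \<noteq> (\<lambda>s. \<zero>\<^bsub>L\<^esub>)"
      "\<And>q. q \<in> set \<phi> \<Longrightarrow> Q q y = \<zero>\<^bsub>L\<^esub>"
    using assms(5) by auto
  let ?F' = "L\<lparr>carrier := M\<rparr>"
  have M: "subfield M L" "?K \<subseteq> M" using L.quadratic_tower_subfield[OF tower K] by auto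
  interpret F': field ?F' using L.subfield_iff(2)[OF M(1)] .
  have ext: "generalized_2_extension F ?F' j" "extension_degree F ?F' j = 2 ^ n"
    using generalized_2_extension_quadratic_tower[OF assms(1) L.field_axioms j tower] by auto
  let ?\<kappa> = "\<lambda>v. X.lift B (c v)"
  interpret C: coordinate_extension F V ?F' j B ?\<kappa>
  proof (unfold_locales)
    show "j \<in> ring_hom F ?F'" using j M(2) by (auto simp: ring_hom_def)
    show "finite B" "B \<subseteq> carrier V" by fact+
    show "?\<kappa> v \<in> carrier (free_module ?F' B)" if "v \<in> carrier V" for v
    proof -
      \<comment> \<open>Vectors of V have coordinates in the image of F, which is the bottom of the
        tower and so contained in \<open>M\<close>.\<close>
      have "j (c v s) \<in> M" if "s \<in> B" for s using c(1)[OF \<open>v \<in> carrier V\<close>] M(2) that by auto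
      then show ?thesis using B(1) L.subfield_closed(5)[OF M(1)]
        by (auto simp: free_module_carrier_iff X.lift_def intro: rev_finite_subset[OF B(1)])
    qed
    show "?\<kappa> (u \<oplus>\<^bsub>V\<^esub> v) = ?\<kappa> u \<oplus>\<^bsub>free_module ?F' B\<^esub> ?\<kappa> v"
      if "u \<in> carrier V" "v \<in> carrier V" for u v
    proof -
      have "V.lincomb (\<lambda>b. c u b \<oplus>\<^bsub>F\<^esub> c v b) B = u \<oplus>\<^bsub>V\<^esub> v"
        using V.lincomb_sum[OF B(1) BV c(1)[OF that(1)] c(1)[OF that(2)]] c(2) that by simp
      moreover have "(\<lambda>b. c u b \<oplus>\<^bsub>F\<^esub> c v b) \<in> B \<rightarrow> carrier F"
        using c(1)[OF that(1)] c(1)[OF that(2)] by auto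
      \<comment> \<open>Coordinates are additive by uniqueness: the pointwise sum of coefficients
        represents the sum of the vectors.\<close>
      ultimately have "c (u \<oplus>\<^bsub>V\<^esub> v) b = c u b \<oplus>\<^bsub>F\<^esub> c v b" if "b \<in> B" for b
        using c(3)[of "\<lambda>b. c u b \<oplus>\<^bsub>F\<^esub> c v b" b] that by simp
      then show ?thesis using c(1)[OF that(1)] c(1)[OF that(2)]
        by (auto simp: X.lift_def free_module_simps fun_eq_iff Pi_iff X.j_simps)
    qed
    show "?\<kappa> (a \<odot>\<^bsub>V\<^esub> v) = j a \<odot>\<^bsub>free_module ?F' B\<^esub> ?\<kappa> v"
      if "a \<in> carrier F" "v \<in> carrier V" for a v
    proof -
      have "V.lincomb (\<lambda>b. a \<otimes>\<^bsub>F\<^esub> c v b) B = a \<odot>\<^bsub>V\<^esub> v"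
        using V.lincomb_smult[OF BV c(1)[OF that(2)] that(1)] c(2) that by simp
      moreover have "(\<lambda>b. a \<otimes>\<^bsub>F\<^esub> c v b) \<in> B \<rightarrow> carrier F"
        using c(1)[OF that(2)] that(1) by auto
      ultimately have "c (a \<odot>\<^bsub>V\<^esub> v) b = a \<otimes>\<^bsub>F\<^esub> c v b" if "b \<in> B" for b
        using c(3)[of "\<lambda>b. a \<otimes>\<^bsub>F\<^esub> c v b" b] that by simp
      then show ?thesis using c(1)[OF that(2)] that(1)
        by (auto simp: X.lift_def free_module_simps fun_eq_iff Pi_iff X.j_simps)
    qed
    show "?\<kappa> b = free_gen ?F' b" if "b \<in> B" for b
    proof -
      let ?d = "\<lambda>w. if w = b then \<one>\<^bsub>F\<^esub> else \<zero>\<^bsub>F\<^esub>"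
      have "c b s = ?d s" if "s \<in> B" for s
        using c(3)[of ?d s] V.lincomb_delta[OF B(1) BV \<open>b \<in> B\<close>] that by simp
      then show ?thesis using that by (auto simp: X.lift_def free_gen_def fun_eq_iff X.j_simps)
    qed
  qed
  have "isotropic ?F' (scalar_ext F ?F' j V) (scalar_ext_system F ?F' j V \<phi>)"
  proof (rule C.isotropic_scalar_ext[OF assms(6), of Q y])
    fix q assume q: "q \<in> set \<phi>"
    \<comment> \<open>\<open>Q q\<close> extends \<open>q\<close> along \<open>lift\<close>; applied
      to the coefficients \<open>c v\<close>, whose combination is \<open>v\<close>, this gives the
      required value j (q v).\<close>
    show "quadratic_form ?F' (free_module ?F' B) (Q q) \<and> Q q y = \<zero>\<^bsub>?F'\<^esub> \<and>
        (\<forall>v \<in> carrier V. Q q (?\<kappa> v) = j (q v))"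
      using L.quadratic_form_restrict_carrier[OF Q(1,2)[OF q] M] y(3)[OF q] Q(3)[OF q c(1)] c(2) by simp
  qed (use y in auto)
  moreover have "extension_degree F ?F' j \<le> 2 ^ r" using ext(2) n by simp
  ultimately show ?thesis using ext(1) by blast
qed

end
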